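(* Let $\mu>0$. Then the matrix $\Upsilon\mathsf K+\mu I_{N_{\mathrm{eff}}}$ is nonsingular, and the unique solution $\delta\theta\in\mathbb R^P$ of the damped Gauss--Newton system $$(\widehat{\mathrm G}+\mu I_P)\,\delta\theta=\nabla\widehat{\mathcal L}(\theta)$$ is obtained from the compressed system $$(\Upsilon\mathsf K+\mu I_{N_{\mathrm{eff}}})\,y=\rho_{\mathrm c},\qquad \delta\theta=\mathsf C^\top y .$$
   Context: Domain: $d=d_x+d_\xi$; $\Omega=\mathcal D_1\times\cdots\times\mathcal D_{d_x}$, $\Xi=\mathcal D_{d_x+1}\times\cdots\times\mathcal D_d$, $\mathcal D=\Omega\times\Xi$, where $\mathcal D_m=(z_m^-,z_m^+)\subset\mathbb R$ are bounded open intervals. $L^2(\mathcal D)$ is identified with $\bigotimes_m L^2(\mathcal D_m)$. Operator: $V$ is a Hilbert space of functions on $\Omega$ with bounded trace $V\to L^2(\partial\Omega)$, $U=L^2(\Xi;V)$, $\mathcal A:U\to L^2(\mathcal D)$ bounded linear. There are Hilbert spaces $H_m\hookrightarrow L^2(\mathcal D_m)$ such that $H=H_1\otimes\cdots\otimes H_d$ (Hilbert tensor product) satisfies $\|v_1\otimes\cdots\otimes v_d\|_H=\prod_m\|v_m\|_{H_m}$, is continuously and densely embedded in $U$, and $\mathcal A|_H=\sum_{\beta=1}^{R_{\mathcal A}}\mathcal A_1^{(\beta)}\otimes\cdots\otimes\mathcal A_d^{(\beta)}$ with bounded linear $\mathcal A_m^{(\beta)}:H_m\to L^2(\mathcal D_m)$.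 Architecture: $\theta=(\theta^1,\dots,\theta^d)$, $\theta^m\in\mathbb R^{P_m}$, $P=\sum_mP_m$; differentiable maps $\mathbb R^{P_m}\to H_m^{k_m}$, $\theta^m\mapsto(w_m^1,\dots,w_m^{k_m})$; fixed $c\in\mathbb R^{k_1\times\cdots\times k_d}$; $u_\theta=\sum_{a_1,\dots,a_d}c_{a_1\ldots a_d}\,w_1^{a_1}\otimes\cdots\otimes w_d^{a_d}$. Index convention: $\overline{i_1\ldots i_k}$ is the lexicographic position of $(i_1,\dots,i_k)$ (leftmost index slowest). Collocation: $\mathcal X_m=\{z_{m,1},\dots,z_{m,n_m}\}\subset\mathcal D_m$, $N_{\mathcal D}=\prod_mn_m$, $z_i=(z_{1,i_1},\dots,z_{d,i_d})$ for $i=\overline{i_1\ldots i_d}$. The functions $\mathcal A_m^{(\beta)}w_m^{a}$, $\mathcal A_m^{(\beta)}\partial_{\theta^m_j}w_m^{a}$ have continuous representatives on $\overline{\mathcal D_m}$, and $f$ admits pointwise evaluation. $\mathrm J_s(i,j)=(\mathcal A\partial_{\theta^s_j}u_\theta)(z_i)$, $\mathrm J_\rho=[\mathrm J_1\ \cdots\ \mathrm J_d]\in\mathbb R^{N_{\mathcal D}\times P}$; $\rho(\theta)_i=(\mathcal Au_\theta-f)(z_i)$. The discrete Gramian is $\widehat{\mathrm G}=\frac1{N_{\mathcal D}}\mathrm J_\rho^\top\mathrm J_\rho$ and the discrete gradient is $\nabla\widehat{\mathcal L}(\theta)=\frac1{N_{\mathcal D}}\mathrm J_\rho^\top\rho(\theta)$.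 Compressed quantities: with $i_{-s},a_{-s}$ the multi-indices with $s$-th entry removed, $$\mathsf E_s^{(\beta)}(\overline{i_{-s}},a_s)=\sum_{a_{-s}}c_{a_1\ldots a_d}\prod_{m\ne s}(\mathcal A_m^{(\beta)}w_m^{a_m})(z_{m,i_m}),\quad \mathsf C_s^{(\beta)}(\overline{i_sa_s},j)=(\mathcal A_s^{(\beta)}\partial_{\theta^s_j}w_s^{a_s})(z_{s,i_s}),$$ $$\Psi_s^{(\beta)}(i,\overline{j_sa_s})=\delta_{i_sj_s}\mathsf E_s^{(\beta)}(\overline{i_{-s}},a_s),$$ $\Psi_s=[\Psi_s^{(1)}\ \cdots\ \Psi_s^{(R_{\mathcal A})}]$, $\mathsf C_s$ = vertical stack of $\mathsf C_s^{(1)},\dots,\mathsf C_s^{(R_{\mathcal A})}$, $N_s=R_{\mathcal A}n_sk_s$, $N_{\mathrm{eff}}=\sum_sN_s$, $\Psi=[\Psi_1\ \cdots\ \Psi_d]\in\mathbb R^{N_{\mathcal D}\times N_{\mathrm{eff}}}$, $\mathsf C=\operatorname{diag}(\mathsf C_1,\dots,\mathsf C_d)\in\mathbb R^{N_{\mathrm{eff}}\times P}$. Set $\Upsilon=\frac1{N_{\mathcal D}}\Psi^\top\Psi$, $\rho_{\mathrm c}=\frac1{N_{\mathcal D}}\Psi^\top\rho(\theta)$ and $\mathsf K=\mathsf C\mathsf C^\top$. In this setting one has $\mathrm J_\rho=\Psi\mathsf C$, hence $\widehat{\mathrm G}=\mathsf C^\top\Upsilon\mathsf C$ and $\nabla\widehat{\mathcal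 L}(\theta)=\mathsf C^\top\rho_{\mathrm c}$. *)

theory Defs
  imports
    "HOL-Analysis.Analysis"
    "Jordan_Normal_Form.Matrix"
begin

no_notation Finite_Cartesian_Product.vec_nth (infixl "$" 90)

text \<open>
  Conventions. All indices are 0-based. Points of a product of intervals indexed by a set
  \<open>I\<close> of natural numbers are extensional functions \<open>nat \<Rightarrow> real\<close> on \<open>I\<close>. Elements of spaces of
  functions modulo equality almost everywhere are represented by representatives, so identities
  between them are stated almost everywhere.
\<close>

record 'a fspace =
  carr :: "('a \<Rightarrow> real) set"
  ip :: "('a \<Rightarrow> real) \<Rightarrow> ('a \<Rightarrow> real) \<Rightarrow> real"

definition fnorm :: "'a fspace \<Rightarrow> ('a \<Rightarrow> real) \<Rightarrow> real" where
  "fnorm X f = sqrt (ip X f f)"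

definition L2 :: "'a measure \<Rightarrow> 'a fspace" where
  "L2 M = \<lparr>carr = {f \<in> borel_measurable M. integrable M (\<lambda>x. (f x)\<^sup>2)},
           ip = (\<lambda>f g. \<integral>x. f x * g x \<partial>M)\<rparr>"

locale hilbert_function_space =
  fixes M :: "'a measure" and X :: "'a fspace"
  assumes measurable: "carr X \<subseteq> borel_measurable M"
    and zero_mem: "(\<lambda>_. 0) \<in> carr X"
    and add_mem: "\<lbrakk>f \<in> carr X; g \<in> carr X\<rbrakk> \<Longrightarrow> (\<lambda>x. f x + g x) \<in> carr X"
    and scale_mem: "f \<in> carr X \<Longrightarrow> (\<lambda>x. r * f x) \<in> carr X"
    and AE_mem: "\<lbrakk>f \<in> carr X; g \<in> borel_measurable M; AE x in M. f x = g x\<rbrakk> \<Longrightarrow> g \<in> carr X"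
    and ip_sym: "\<lbrakk>f \<in> carr X; g \<in> carr X\<rbrakk> \<Longrightarrow> ip X f g = ip X g f"
    and ip_add: "\<lbrakk>f \<in> carr X; g \<in> carr X; h \<in> carr X\<rbrakk>
                 \<Longrightarrow> ip X (\<lambda>x. f x + g x) h = ip X f h + ip X g h"
    and ip_scale: "\<lbrakk>f \<in> carr X; h \<in> carr X\<rbrakk> \<Longrightarrow> ip X (\<lambda>x. r * f x) h = r * ip X f h"
    and ip_nonneg: "f \<in> carr X \<Longrightarrow> ip X f f \<ge> 0"
    and ip_zero_iff: "f \<in> carr X \<Longrightarrow> ip X f f = 0 \<longleftrightarrow> (AE x in M. f x = 0)"
    and complete:
      "\<lbrakk>\<And>n. F n \<in> carr X;
        \<And>e. e > 0 \<Longrightarrow> \<exists>N. \<forall>m\<ge>N. \<forall>n\<ge>N. fnorm X (\<lambda>x. F m x - F n x) < e\<rbrakk>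
       \<Longrightarrow> \<exists>f\<in>carr X. (\<lambda>n. fnorm X (\<lambda>x. F n x - f x)) \<longlonglongrightarrow> 0"

definition continuously_embedded :: "'a fspace \<Rightarrow> 'a fspace \<Rightarrow> bool" where
  "continuously_embedded X Y \<longleftrightarrow>
     carr X \<subseteq> carr Y \<and> (\<exists>B. \<forall>f\<in>carr X. fnorm Y f \<le> B * fnorm X f)"

definition densely_embedded :: "'a fspace \<Rightarrow> 'a fspace \<Rightarrow> bool" where
  "densely_embedded X Y \<longleftrightarrow>
     carr X \<subseteq> carr Y \<and> (\<forall>g\<in>carr Y. \<forall>e>0. \<exists>f\<in>carr X. fnorm Y (\<lambda>x. g x - f x) < e)"

text \<open>
  Bounded linear operators into an \<open>L\<^sup>2\<close> space. Linearity (almost everywhere) and boundedness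
  together make \<open>T\<close> independent of the chosen representatives.
\<close>

definition bounded_operator :: "'a fspace \<Rightarrow> 'b measure \<Rightarrow> (('a \<Rightarrow> real) \<Rightarrow> ('b \<Rightarrow> real)) \<Rightarrow> bool"
  where
  "bounded_operator X N T \<longleftrightarrow>
     (\<forall>f\<in>carr X. T f \<in> carr (L2 N)) \<and>
     (\<forall>f\<in>carr X. \<forall>g\<in>carr X. AE y in N. T (\<lambda>x. f x + g x) y = T f y + T g y) \<and>
     (\<forall>f\<in>carr X. \<forall>r. AE y in N. T (\<lambda>x. r * f x) y = r * T f y) \<and>
     (\<exists>B. \<forall>f\<in>carr X. fnorm (L2 N) (T f) \<le> B * fnorm X f)"

definition curve_deriv :: "'a fspace \<Rightarrow> (real \<Rightarrow> 'a \<Rightarrow> real) \<Rightarrow> ('a \<Rightarrow> real)" where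
  "curve_deriv X F =
     (SOME D. D \<in> carr X \<and>
        ((\<lambda>t. fnorm X (\<lambda>x. (F t x - F 0 x) / t - D x)) \<longlongrightarrow> 0) (at 0))"

text \<open>
  Frechet differentiability of a map from \<open>p\<close>-dimensional Euclidean space to \<open>X\<close>;
  the derivative is the linear map \<open>h \<mapsto> \<Sum>j<p. h\<^sub>j D\<^sub>j\<close>.
\<close>

definition frechet_differentiable ::
  "'a fspace \<Rightarrow> nat \<Rightarrow> (real Matrix.vec \<Rightarrow> 'a \<Rightarrow> real) \<Rightarrow> real Matrix.vec \<Rightarrow> bool" where
  "frechet_differentiable X p F v \<longleftrightarrow>
     (\<exists>D :: nat \<Rightarrow> 'a \<Rightarrow> real. (\<forall>j<p. D j \<in> carr X) \<and>
        (\<forall>e>0. \<exists>r>0. \<forall>h\<in>carrier_vec p. sqrt (h \<bullet> h) < r \<longrightarrow>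
           fnorm X (\<lambda>x. F (v + h) x - F v x - (\<Sum>j<p. h $ j * D j x)) \<le> e * sqrt (h \<bullet> h)))"

text \<open>
  Pointwise evaluation of an almost-everywhere class through its representative that is
  continuous on \<open>K\<close>.
\<close>

definition has_cont_rep :: "'a::topological_space measure \<Rightarrow> 'a set \<Rightarrow> ('a \<Rightarrow> real) \<Rightarrow> bool" where
  "has_cont_rep M K f \<longleftrightarrow> (\<exists>g. continuous_on K g \<and> (AE x in M. f x = g x))"

definition pt_eval :: "'a::topological_space measure \<Rightarrow> 'a set \<Rightarrow> ('a \<Rightarrow> real) \<Rightarrow> 'a \<Rightarrow> real" where
  "pt_eval M K f z =
     (THE y. \<exists>g. continuous_on K g \<and> (AE x in M. f x = g x) \<and> y = g z)"

definition tensor :: "nat \<Rightarrow> (nat \<Rightarrow> real \<Rightarrow> real) \<Rightarrow> (nat \<Rightarrow> real) \<Rightarrow> real" where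
  "tensor d v = (\<lambda>z. \<Prod>m<d. v m (z m))"

text \<open>
  The Hilbert tensor product of \<open>Hm 0, \<dots>, Hm (d - 1)\<close>, realised inside \<open>L\<^sup>2\<close> of the product
  domain: the inner product is multiplicative on elementary tensors, which have dense span.
\<close>

definition hilbert_tensor_product ::
  "nat \<Rightarrow> (nat \<Rightarrow> real measure) \<Rightarrow> (nat \<Rightarrow> real fspace) \<Rightarrow> (nat \<Rightarrow> real) fspace \<Rightarrow> bool" where
  "hilbert_tensor_product d M Hm H \<longleftrightarrow>
     hilbert_function_space (PiM {..<d} M) H \<and>
     continuously_embedded H (L2 (PiM {..<d} M)) \<and>
     (\<forall>v. (\<forall>m<d. v m \<in> carr (Hm m)) \<longrightarrow> tensor d v \<in> carr H) \<and>
     (\<forall>v v'. (\<forall>m<d. v m \<in> carr (Hm m) \<and> v' m \<in> carr (Hm m)) \<longrightarrow>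
        ip H (tensor d v) (tensor d v') = (\<Prod>m<d. ip (Hm m) (v m) (v' m))) \<and>
     (\<forall>h\<in>carr H. \<forall>e>0. \<exists>(l::nat) q v.
        (\<forall>i<l. \<forall>m<d. v i m \<in> carr (Hm m)) \<and>
        fnorm H (\<lambda>z. h z - (\<Sum>i<l. q i * tensor d (v i) z)) < e)"

definition tensor_operator ::
  "nat \<Rightarrow> (nat \<Rightarrow> real measure) \<Rightarrow> (nat \<Rightarrow> real fspace) \<Rightarrow> (nat \<Rightarrow> real) fspace \<Rightarrow>
   (nat \<Rightarrow> (real \<Rightarrow> real) \<Rightarrow> (real \<Rightarrow> real)) \<Rightarrow>
   (((nat \<Rightarrow> real) \<Rightarrow> real) \<Rightarrow> ((nat \<Rightarrow> real) \<Rightarrow> real)) \<Rightarrow> bool" where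
  "tensor_operator d M Hm H Tm T \<longleftrightarrow>
     bounded_operator H (PiM {..<d} M) T \<and>
     (\<forall>v. (\<forall>m<d. v m \<in> carr (Hm m)) \<longrightarrow>
        (AE z in PiM {..<d} M. T (tensor d v) z = tensor d (\<lambda>m. Tm m (v m)) z))"

text \<open>
  \<open>L\<^sup>2(\<Xi>; V)\<close> with \<open>V\<close> a space of functions on the box with index set \<open>I\<close> and \<open>\<Xi>\<close> a box with
  index set \<open>J\<close> and measure \<open>N\<close>. A map from \<open>\<Xi>\<close> to \<open>V\<close> is stored uncurried, as a function on
  \<open>\<Omega> \<times> \<Xi>\<close> (no joint measurability required). Membership requires strong measurability, i.e.
  being an almost everywhere limit of \<open>V\<close>-valued simple functions. The measure \<open>N\<close> should be
  complete, so that almost everywhere limits of measurable functions are measurable.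
\<close>

definition slice ::
  "nat set \<Rightarrow> nat set \<Rightarrow> ((nat \<Rightarrow> real) \<Rightarrow> real) \<Rightarrow> (nat \<Rightarrow> real) \<Rightarrow> (nat \<Rightarrow> real) \<Rightarrow> real" where
  "slice I J u \<xi> = (\<lambda>x. u (merge I J (x, \<xi>)))"

definition bochner_L2 ::
  "nat set \<Rightarrow> nat set \<Rightarrow> (nat \<Rightarrow> real) measure \<Rightarrow> (nat \<Rightarrow> real) fspace \<Rightarrow> (nat \<Rightarrow> real) fspace" where
  "bochner_L2 I J N V =
     \<lparr>carr = {u. (AE \<xi> in N. slice I J u \<xi> \<in> carr V) \<and>
                (\<exists>s. (\<forall>n. simple_function N (s n) \<and> (\<forall>\<xi>\<in>space N. s n \<xi> \<in> carr V)) \<and>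
                     (AE \<xi> in N. (\<lambda>n. fnorm V (\<lambda>x. slice I J u \<xi> x - s n \<xi> x)) \<longlonglongrightarrow> 0)) \<and>
                integrable N (\<lambda>\<xi>. (fnorm V (slice I J u \<xi>))\<^sup>2)},
      ip = (\<lambda>u v. \<integral>\<xi>. ip V (slice I J u \<xi>) (slice I J v \<xi>) \<partial>N)\<rparr>"

text \<open>
  Surface measure on the boundary of the box with sides \<open>(a m, b m)\<close>, \<open>m < d\<close>: the sum over the
  \<open>2d\<close> faces \<open>x m \<in> {a m, b m}\<close> of the \<open>(d - 1)\<close>-dimensional Lebesgue measure.
\<close>

definition interval_measure_at :: "(nat \<Rightarrow> real) \<Rightarrow> (nat \<Rightarrow> real) \<Rightarrow> nat \<Rightarrow> real measure" where
  "interval_measure_at a b m = restrict_space lborel {a m<..<b m}"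

definition box_boundary :: "nat \<Rightarrow> (nat \<Rightarrow> real) \<Rightarrow> (nat \<Rightarrow> real) \<Rightarrow> (nat \<Rightarrow> real) measure" where
  "box_boundary d a b =
     (let N = PiM {..<d} (\<lambda>_. borel) in
      measure_of (space N) (sets N)
        (\<lambda>A. \<Sum>m<d. \<Sum>e\<in>{a m, b m}.
           emeasure (distr (PiM ({..<d} - {m}) (interval_measure_at a b)) N (\<lambda>x. x(m := e))) A))"

text \<open>
  What makes a bounded operator \<open>\<gamma>\<close> a trace is that it restricts every element of \<open>V\<close> that is
  continuous up to the boundary.
\<close>

definition bounded_trace ::
  "nat \<Rightarrow> (nat \<Rightarrow> real) \<Rightarrow> (nat \<Rightarrow> real) \<Rightarrow> (nat \<Rightarrow> real) fspace \<Rightarrow>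
   (((nat \<Rightarrow> real) \<Rightarrow> real) \<Rightarrow> ((nat \<Rightarrow> real) \<Rightarrow> real)) \<Rightarrow> bool" where
  "bounded_trace d a b V \<gamma> \<longleftrightarrow>
     bounded_operator V (box_boundary d a b) \<gamma> \<and>
     (\<forall>v\<in>carr V. \<forall>g. continuous_on (\<Pi>\<^sub>E m\<in>{..<d}. {a m..b m}) g \<longrightarrow>
        (AE x in PiM {..<d} (interval_measure_at a b). v x = g x) \<longrightarrow>
        (AE x in box_boundary d a b. \<gamma> v x = g x))"

record problem =
  dim_x :: nat
  dim_xi :: nat
  lend :: "nat \<Rightarrow> real"  \<comment> \<open>\<open>z\<^sub>m\<^sup>-\<close>\<close>
  rend :: "nat \<Rightarrow> real"  \<comment> \<open>\<open>z\<^sub>m\<^sup>+\<close>\<close>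
  V_space :: "(nat \<Rightarrow> real) fspace"
  op_A :: "((nat \<Rightarrow> real) \<Rightarrow> real) \<Rightarrow> ((nat \<Rightarrow> real) \<Rightarrow> real)"
  H_factor :: "nat \<Rightarrow> real fspace"
  H_space :: "(nat \<Rightarrow> real) fspace"
  op_rank :: nat
  op_factor :: "nat \<Rightarrow> nat \<Rightarrow> (real \<Rightarrow> real) \<Rightarrow> (real \<Rightarrow> real)"
    \<comment> \<open>\<open>op_factor S \<beta> m\<close> acts in coordinate \<open>m\<close>\<close>
  num_par :: "nat \<Rightarrow> nat"  \<comment> \<open>\<open>P\<^sub>m\<close>\<close>
  num_basis :: "nat \<Rightarrow> nat"  \<comment> \<open>\<open>k\<^sub>m\<close>\<close>
  basis :: "nat \<Rightarrow> nat \<Rightarrow> real Matrix.vec \<Rightarrow> real \<Rightarrow> real"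
    \<comment> \<open>\<open>basis S m a \<theta>\<^sup>m\<close> is \<open>w\<^sub>m\<^sup>a\<close>\<close>
  core :: "nat list \<Rightarrow> real"  \<comment> \<open>the tensor \<open>c\<close>\<close>
  num_pts :: "nat \<Rightarrow> nat"  \<comment> \<open>\<open>n\<^sub>m\<close>\<close>
  colloc :: "nat \<Rightarrow> nat \<Rightarrow> real"  \<comment> \<open>\<open>colloc S m i\<close> is \<open>z\<^sub>m\<^sub>,\<^sub>i\<close>\<close>
  rhs :: "(nat \<Rightarrow> real) \<Rightarrow> real"  \<comment> \<open>\<open>f\<close>\<close>

definition dim_total :: "problem \<Rightarrow> nat" where
  "dim_total S = dim_x S + dim_xi S"

definition interval_M :: "problem \<Rightarrow> nat \<Rightarrow> real measure" where
  "interval_M S = interval_measure_at (lend S) (rend S)"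

definition Omega_M :: "problem \<Rightarrow> (nat \<Rightarrow> real) measure" where
  "Omega_M S = PiM {..<dim_x S} (interval_M S)"

definition Xi_M :: "problem \<Rightarrow> (nat \<Rightarrow> real) measure" where
  "Xi_M S = completion (PiM {dim_x S..<dim_total S} (interval_M S))"

definition domain_M :: "problem \<Rightarrow> (nat \<Rightarrow> real) measure" where
  "domain_M S = PiM {..<dim_total S} (interval_M S)"

definition U_space :: "problem \<Rightarrow> (nat \<Rightarrow> real) fspace" where
  "U_space S = bochner_L2 {..<dim_x S} {dim_x S..<dim_total S} (Xi_M S) (V_space S)"

definition eval1 :: "problem \<Rightarrow> nat \<Rightarrow> (real \<Rightarrow> real) \<Rightarrow> real \<Rightarrow> real" where
  "eval1 S m f z = pt_eval (interval_M S m) {lend S m..rend S m} f z"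

definition eval_dom :: "problem \<Rightarrow> ((nat \<Rightarrow> real) \<Rightarrow> real) \<Rightarrow> (nat \<Rightarrow> real) \<Rightarrow> real" where
  "eval_dom S f z =
     pt_eval (domain_M S) (\<Pi>\<^sub>E m\<in>{..<dim_total S}. {lend S m..rend S m}) f z"

text \<open>
  All multi-indices \<open>[i\<^sub>0, \<dots>, i\<^bsub>d-1\<^esub>]\<close> with \<open>i\<^sub>m < N m\<close>, listed lexicographically with the leftmost
  index slowest; the multi-index at lexicographic position \<open>r\<close> is \<open>multi_indices d N ! r\<close>.
  Likewise a pair \<open>(i, a)\<close> with \<open>a < k\<close> has position \<open>i * k + a\<close>.
\<close>

definition multi_indices :: "nat \<Rightarrow> (nat \<Rightarrow> nat) \<Rightarrow> nat list list" where
  "multi_indices d N = product_lists (map (\<lambda>m. [0..<N m]) [0..<d])"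

abbreviation grid_index :: "problem \<Rightarrow> nat \<Rightarrow> nat list" where
  "grid_index S r \<equiv> multi_indices (dim_total S) (num_pts S) ! r"

definition colloc_pt :: "problem \<Rightarrow> nat list \<Rightarrow> nat \<Rightarrow> real" where
  "colloc_pt S i = (\<lambda>m\<in>{..<dim_total S}. colloc S m (i ! m))"

definition u_net :: "problem \<Rightarrow> (nat \<Rightarrow> real Matrix.vec) \<Rightarrow> (nat \<Rightarrow> real) \<Rightarrow> real" where
  "u_net S \<theta> = (\<lambda>z. \<Sum>a\<in>set (multi_indices (dim_total S) (num_basis S)).
      core S a * tensor (dim_total S) (\<lambda>m. basis S m (a ! m) (\<theta> m)) z)"

definition partial_basis ::
  "problem \<Rightarrow> (nat \<Rightarrow> real Matrix.vec) \<Rightarrow> nat \<Rightarrow> nat \<Rightarrow> nat \<Rightarrow> real \<Rightarrow> real" where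
  "partial_basis S \<theta> m j a =
     curve_deriv (H_factor S m)
       (\<lambda>t. basis S m a (\<theta> m + t \<cdot>\<^sub>v unit_vec (num_par S m) j))"

definition partial_u ::
  "problem \<Rightarrow> (nat \<Rightarrow> real Matrix.vec) \<Rightarrow> nat \<Rightarrow> nat \<Rightarrow> (nat \<Rightarrow> real) \<Rightarrow> real" where
  "partial_u S \<theta> s j =
     curve_deriv (H_space S)
       (\<lambda>t. u_net S (\<theta>(s := \<theta> s + t \<cdot>\<^sub>v unit_vec (num_par S s) j)))"

locale separable_setting =
  fixes S :: problem and \<theta> :: "nat \<Rightarrow> real Matrix.vec"
  assumes intervals: "m < dim_total S \<Longrightarrow> lend S m < rend S m"
    and V_hilbert: "hilbert_function_space (Omega_M S) (V_space S)"
    and V_trace: "\<exists>\<gamma>. bounded_trace (dim_x S) (lend S) (rend S) (V_space S) \<gamma>"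
    and A_bounded: "bounded_operator (U_space S) (domain_M S) (op_A S)"
    and Hm_hilbert: "m < dim_total S \<Longrightarrow> hilbert_function_space (interval_M S m) (H_factor S m)"
    and Hm_embedded: "m < dim_total S \<Longrightarrow>
          continuously_embedded (H_factor S m) (L2 (interval_M S m))"
    and H_tensor: "hilbert_tensor_product (dim_total S) (interval_M S) (H_factor S) (H_space S)"
    and H_continuous: "continuously_embedded (H_space S) (U_space S)"
    and H_dense: "densely_embedded (H_space S) (U_space S)"
    and Am_bounded: "\<lbrakk>\<beta> < op_rank S; m < dim_total S\<rbrakk> \<Longrightarrow>
          bounded_operator (H_factor S m) (interval_M S m) (op_factor S \<beta> m)"
    and A_separable:
      "\<exists>T. (\<forall>\<beta><op_rank S. tensor_operator (dim_total S) (interval_M S)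
               (H_factor S) (H_space S) (op_factor S \<beta>) (T \<beta>)) \<and>
           (\<forall>h\<in>carr (H_space S). AE z in domain_M S. op_A S h z = (\<Sum>\<beta><op_rank S. T \<beta> h z))"
    and basis_mem: "\<lbrakk>m < dim_total S; a < num_basis S m; v \<in> carrier_vec (num_par S m)\<rbrakk> \<Longrightarrow>
          basis S m a v \<in> carr (H_factor S m)"
    and basis_diff: "\<lbrakk>m < dim_total S; a < num_basis S m; v \<in> carrier_vec (num_par S m)\<rbrakk> \<Longrightarrow>
          frechet_differentiable (H_factor S m) (num_par S m) (basis S m a) v"
    and theta_dim: "m < dim_total S \<Longrightarrow> \<theta> m \<in> carrier_vec (num_par S m)"
    and num_pts_pos: "m < dim_total S \<Longrightarrow> num_pts S m > 0"
    and colloc_mem: "\<lbrakk>m < dim_total S; i < num_pts S m\<rbrakk> \<Longrightarrow>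
          colloc S m i \<in> {lend S m<..<rend S m}"
    and cont_rep: "\<lbrakk>\<beta> < op_rank S; m < dim_total S; a < num_basis S m\<rbrakk> \<Longrightarrow>
          has_cont_rep (interval_M S m) {lend S m..rend S m}
            (op_factor S \<beta> m (basis S m a (\<theta> m)))"
    and cont_rep_partial:
      "\<lbrakk>\<beta> < op_rank S; m < dim_total S; a < num_basis S m; j < num_par S m\<rbrakk> \<Longrightarrow>
          has_cont_rep (interval_M S m) {lend S m..rend S m}
            (op_factor S \<beta> m (partial_basis S \<theta> m j a))"
    and rhs_L2: "rhs S \<in> carr (L2 (domain_M S))"

definition append_cols :: "real mat \<Rightarrow> real mat \<Rightarrow> real mat" where
  "append_cols A B = four_block_mat A B (0\<^sub>m 0 (dim_col A)) (0\<^sub>m 0 (dim_col B))"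

definition hcat :: "nat \<Rightarrow> real mat list \<Rightarrow> real mat" where
  "hcat nr As = foldr append_cols As (0\<^sub>m nr 0)"

definition vcat :: "nat \<Rightarrow> real mat list \<Rightarrow> real mat" where
  "vcat nc As = foldr append_rows As (0\<^sub>m 0 nc)"

definition N_D :: "problem \<Rightarrow> nat" where
  "N_D S = (\<Prod>m<dim_total S. num_pts S m)"

definition P_total :: "problem \<Rightarrow> nat" where
  "P_total S = (\<Sum>m<dim_total S. num_par S m)"

definition jac_block :: "problem \<Rightarrow> (nat \<Rightarrow> real Matrix.vec) \<Rightarrow> nat \<Rightarrow> real mat" where
  "jac_block S \<theta> s = mat (N_D S) (num_par S s)
     (\<lambda>(r, j). eval_dom S (op_A S (partial_u S \<theta> s j)) (colloc_pt S (grid_index S r)))"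

definition jac :: "problem \<Rightarrow> (nat \<Rightarrow> real Matrix.vec) \<Rightarrow> real mat" where
  "jac S \<theta> = hcat (N_D S) (map (jac_block S \<theta>) [0..<dim_total S])"

definition residual :: "problem \<Rightarrow> (nat \<Rightarrow> real Matrix.vec) \<Rightarrow> real Matrix.vec" where
  "residual S \<theta> = Matrix.vec (N_D S)
     (\<lambda>r. let z = colloc_pt S (grid_index S r) in eval_dom S (op_A S (u_net S \<theta>)) z - rhs S z)"

definition Gram :: "problem \<Rightarrow> (nat \<Rightarrow> real Matrix.vec) \<Rightarrow> real mat" where
  "Gram S \<theta> = (1 / real (N_D S)) \<cdot>\<^sub>m (transpose_mat (jac S \<theta>) * jac S \<theta>)"

definition grad :: "problem \<Rightarrow> (nat \<Rightarrow> real Matrix.vec) \<Rightarrow> real Matrix.vec" where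
  "grad S \<theta> = (1 / real (N_D S)) \<cdot>\<^sub>v (transpose_mat (jac S \<theta>) *\<^sub>v residual S \<theta>)"

text \<open>
  \<open>E_entry S \<theta> s \<beta> i b\<close> is the entry of \<open>E\<^sub>s\<^sup>(\<^sup>\<beta>\<^sup>)\<close> in the row of \<open>i\<close> with its \<open>s\<close>-th index removed
  and in column \<open>b\<close>; it does not depend on \<open>i ! s\<close>.
\<close>

definition E_entry ::
  "problem \<Rightarrow> (nat \<Rightarrow> real Matrix.vec) \<Rightarrow> nat \<Rightarrow> nat \<Rightarrow> nat list \<Rightarrow> nat \<Rightarrow> real" where
  "E_entry S \<theta> s \<beta> i b =
     (\<Sum>a\<in>{a \<in> set (multi_indices (dim_total S) (num_basis S)). a ! s = b}.
        core S a * (\<Prod>m\<in>{..<dim_total S} - {s}.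
          eval1 S m (op_factor S \<beta> m (basis S m (a ! m) (\<theta> m))) (colloc S m (i ! m))))"

definition Psi_block2 ::
  "problem \<Rightarrow> (nat \<Rightarrow> real Matrix.vec) \<Rightarrow> nat \<Rightarrow> nat \<Rightarrow> real mat" where
  "Psi_block2 S \<theta> s \<beta> = mat (N_D S) (num_pts S s * num_basis S s)
     (\<lambda>(r, q). let i = grid_index S r in
        if i ! s = q div num_basis S s then E_entry S \<theta> s \<beta> i (q mod num_basis S s) else 0)"

definition Psi_block :: "problem \<Rightarrow> (nat \<Rightarrow> real Matrix.vec) \<Rightarrow> nat \<Rightarrow> real mat" where
  "Psi_block S \<theta> s = hcat (N_D S) (map (Psi_block2 S \<theta> s) [0..<op_rank S])"

definition Psi :: "problem \<Rightarrow> (nat \<Rightarrow> real Matrix.vec) \<Rightarrow> real mat" where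
  "Psi S \<theta> = hcat (N_D S) (map (Psi_block S \<theta>) [0..<dim_total S])"

definition C_block2 ::
  "problem \<Rightarrow> (nat \<Rightarrow> real Matrix.vec) \<Rightarrow> nat \<Rightarrow> nat \<Rightarrow> real mat" where
  "C_block2 S \<theta> s \<beta> = mat (num_pts S s * num_basis S s) (num_par S s)
     (\<lambda>(q, j). eval1 S s (op_factor S \<beta> s (partial_basis S \<theta> s j (q mod num_basis S s)))
                 (colloc S s (q div num_basis S s)))"

definition C_block :: "problem \<Rightarrow> (nat \<Rightarrow> real Matrix.vec) \<Rightarrow> nat \<Rightarrow> real mat" where
  "C_block S \<theta> s = vcat (num_par S s) (map (C_block2 S \<theta> s) [0..<op_rank S])"

definition C_mat :: "problem \<Rightarrow> (nat \<Rightarrow> real Matrix.vec) \<Rightarrow> real mat" where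
  "C_mat S \<theta> = diag_block_mat (map (C_block S \<theta>) [0..<dim_total S])"

definition N_eff :: "problem \<Rightarrow> nat" where
  "N_eff S = (\<Sum>s<dim_total S. op_rank S * num_pts S s * num_basis S s)"

definition Upsilon :: "problem \<Rightarrow> (nat \<Rightarrow> real Matrix.vec) \<Rightarrow> real mat" where
  "Upsilon S \<theta> = (1 / real (N_D S)) \<cdot>\<^sub>m (transpose_mat (Psi S \<theta>) * Psi S \<theta>)"

definition rho_c :: "problem \<Rightarrow> (nat \<Rightarrow> real Matrix.vec) \<Rightarrow> real Matrix.vec" where
  "rho_c S \<theta> = (1 / real (N_D S)) \<cdot>\<^sub>v (transpose_mat (Psi S \<theta>) *\<^sub>v residual S \<theta>)"

definition K_mat :: "problem \<Rightarrow> (nat \<Rightarrow> real Matrix.vec) \<Rightarrow> real mat" where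
  "K_mat S \<theta> = C_mat S \<theta> * transpose_mat (C_mat S \<theta>)"

end

theory Submission
  imports Defs "Jordan_Normal_Form.Determinant"
begin

text \<open>
  The Gramian factors as \<open>C\<^sup>T \<Upsilon> C\<close> with \<open>\<Upsilon>\<close> positive semidefinite, and
  \<open>C\<^sup>T (\<Upsilon> C C\<^sup>T + \<mu>) = (C\<^sup>T \<Upsilon> C + \<mu>) C\<^sup>T\<close>. Since \<open>C\<^sup>T \<Upsilon> C + \<mu>\<close> is positive definite, a kernel vector
  \<open>y\<close> of \<open>\<Upsilon> C C\<^sup>T + \<mu>\<close> has \<open>C\<^sup>T y = 0\<close>, hence \<open>\<mu> y = 0\<close>; and \<open>C\<^sup>T\<close> carries compressed solutions to
  Gauss-Newton solutions.

  The analytic content is the factorization \<open>J = \<Psi> C\<close>. The curve derivative of \<open>u\<^sub>\<theta>\<close> in \<open>H\<close> is the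
  sum of elementary tensors obtained by the product rule, up to a null set, because the norm of
  \<open>H\<close> is multiplicative on elementary tensors. The operator acts factorwise on these tensors, and
  the result is evaluated through products of the continuous representatives of the factors: a
  neighbourhood of an interior point of the box has positive measure, so the value of a continuous
  representative at a collocation point is unique.
\<close>

section \<open>Damped systems and block matrices\<close>

text \<open>Over a field a trivial kernel forces a nonzero determinant, and a matrix with nonzero
  determinant is a unit of the matrix ring; being a unit there supplies the two-sided
  inverse.\<close>

lemma trivial_kernel_imp_inverse:
  fixes A :: "'a :: field mat"
  assumes A: "A \<in> carrier_mat n n"
    and ker: "\<And>v. v \<in> carrier_vec n \<Longrightarrow> A *\<^sub>v v = 0\<^sub>v n \<Longrightarrow> v = 0\<^sub>v n"
  obtains B where "B \<in> carrier_mat n n" "A * B = 1\<^sub>m n" "B * A = 1\<^sub>m n"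
proof -
  have "det A \<noteq> 0"
    using det_0_iff_vec_prod_zero[OF A] ker by blast
  \<comment> \<open>The free argument is the extension field of the ring record; any value
    serves.\<close>
  from det_non_zero_imp_unit[OF A this, of "()"] obtain B where
    "B \<in> carrier_mat n n" "A * B = 1\<^sub>m n" "B * A = 1\<^sub>m n"
    unfolding Units_def ring_mat_def by auto
  then show ?thesis by (rule that)
qed

lemma trivial_kernel_imp_ex1_solution:
  fixes A :: "'a :: field mat"
  assumes A: "A \<in> carrier_mat n n"
    and ker: "\<And>v. v \<in> carrier_vec n \<Longrightarrow> A *\<^sub>v v = 0\<^sub>v n \<Longrightarrow> v = 0\<^sub>v n"
    and b: "b \<in> carrier_vec n"
  shows "\<exists>!v. v \<in> carrier_vec n \<and> A *\<^sub>v v = b"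
proof -
  obtain B where B: "B \<in> carrier_mat n n" "A * B = 1\<^sub>m n" "B * A = 1\<^sub>m n"
    using trivial_kernel_imp_inverse[OF A ker] by blast
  show ?thesis
  proof (intro ex1I[of _ "B *\<^sub>v b"] conjI)
    show "B *\<^sub>v b \<in> carrier_vec n" using B(1) b by simp
    show "A *\<^sub>v (B *\<^sub>v b) = b"
      using assoc_mult_mat_vec[OF A B(1) b] B(2) b by simp
  next
    fix v assume v: "v \<in> carrier_vec n \<and> A *\<^sub>v v = b"
    then show "v = B *\<^sub>v b"
      using assoc_mult_mat_vec[OF B(1) A, of v] B(3) by simp
  qed
qed

lemma scalar_prod_self_nonneg: "0 \<le> v \<bullet> (v :: real vec)"
  by (simp add: scalar_prod_def sum_nonneg)

lemma scalar_prod_self_eq_0: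
  fixes v :: "real vec"
  assumes "v \<in> carrier_vec n" "v \<bullet> v = 0"
  shows "v = 0\<^sub>v n"
  using assms by (auto simp: scalar_prod_def sum_nonneg_eq_0_iff intro!: eq_vecI)

lemma smult_one_mat_mult_vec:
  fixes v :: "'a :: comm_ring_1 vec"
  assumes "v \<in> carrier_vec n"
  shows "(k \<cdot>\<^sub>m 1\<^sub>m n) *\<^sub>v v = k \<cdot>\<^sub>v v"
  using assms by (auto intro!: eq_vecI)

lemma smult_mat_mult_vec:
  fixes A :: "'a :: comm_ring_1 mat"
  assumes "A \<in> carrier_mat m n" "v \<in> carrier_vec n"
  shows "(k \<cdot>\<^sub>m A) *\<^sub>v v = k \<cdot>\<^sub>v (A *\<^sub>v v)"
  using assms by (intro eq_vecI) (auto simp: scalar_prod_def sum_distrib_left mult.assoc)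

lemma damped_mult_vec:
  fixes A :: "'a :: comm_ring_1 mat"
  assumes "A \<in> carrier_mat n n" "v \<in> carrier_vec n"
  shows "(A + k \<cdot>\<^sub>m 1\<^sub>m n) *\<^sub>v v = A *\<^sub>v v + k \<cdot>\<^sub>v v"
  using assms by (simp add: add_mult_distrib_mat_vec[of _ n n] smult_one_mat_mult_vec)

text \<open>Pairing the equation with \<open>v\<close> makes two nonnegative terms sum to zero, and
  \<open>\<mu> > 0\<close> then forces \<open>v \<bullet> v = 0\<close>. Nonnegativity of the form
  is assumed at this one \<open>v\<close> only.\<close>

lemma psd_damped_kernel:
  fixes A :: "real mat"
  assumes A: "A \<in> carrier_mat n n" and psd: "0 \<le> v \<bullet> (A *\<^sub>v v)"
    and v: "v \<in> carrier_vec n" and mu: "\<mu> > 0"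
    and eq: "A *\<^sub>v v + \<mu> \<cdot>\<^sub>v v = 0\<^sub>v n"
  shows "v = 0\<^sub>v n"
proof -
  have "v \<bullet> (A *\<^sub>v v + \<mu> \<cdot>\<^sub>v v) = v \<bullet> (A *\<^sub>v v) + \<mu> * (v \<bullet> v)"
    using A v by (simp add: scalar_prod_add_distrib[of _ n])
  then have "v \<bullet> (A *\<^sub>v v) + \<mu> * (v \<bullet> v) = 0"
    using v by (simp add: eq)
  with psd mu scalar_prod_self_nonneg[of v] have "v \<bullet> v = 0"
    by (smt (verit) mult_pos_pos)
  then show ?thesis using v by (rule scalar_prod_self_eq_0[rotated])
qed

text \<open>The quadratic form of \<open>J^T J\<close> at \<open>v\<close> is the squared length of
  \<open>J v\<close>.\<close>

lemma scaled_gram_psd: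
  fixes J :: "real mat"
  assumes J: "J \<in> carrier_mat m n" and v: "v \<in> carrier_vec n" and c: "0 \<le> c"
  shows "0 \<le> v \<bullet> ((c \<cdot>\<^sub>m (transpose_mat J * J)) *\<^sub>v v)"
proof -
  have "(c \<cdot>\<^sub>m (transpose_mat J * J)) *\<^sub>v v = c \<cdot>\<^sub>v (transpose_mat J *\<^sub>v (J *\<^sub>v v))"
    using J v by (simp add: smult_mat_mult_vec[of _ n n] assoc_mult_mat_vec[of _ n m])
  moreover have "v \<bullet> (transpose_mat J *\<^sub>v (J *\<^sub>v v)) = (J *\<^sub>v v) \<bullet> (J *\<^sub>v v)"
    using transpose_vec_mult_scalar[OF J v, of "J *\<^sub>v v"] J v
    by (subst comm_scalar_prod[of _ n]) auto
  ultimately show ?thesis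
    using J v c scalar_prod_self_nonneg[of "J *\<^sub>v v"] by simp
qed

text \<open>The algebraic half of the theorem. \<open>M\<close> is in general not symmetric, so
  positivity is applied to \<open>G\<close> alone, and statements about \<open>M\<close> are reached
  by transporting vectors with \<open>C^T\<close>.\<close>

lemma compressed_damped_system:
  fixes C Y :: "real mat" and \<rho> :: "real vec"
  assumes C: "C \<in> carrier_mat n p" and Y: "Y \<in> carrier_mat n n" and r: "\<rho> \<in> carrier_vec n"
    and psd: "\<And>v. v \<in> carrier_vec n \<Longrightarrow> 0 \<le> v \<bullet> (Y *\<^sub>v v)" and mu: "\<mu> > 0"
  defines "G \<equiv> transpose_mat C * Y * C" and "M \<equiv> Y * (C * transpose_mat C)"
  shows "invertible_mat (M + \<mu> \<cdot>\<^sub>m 1\<^sub>m n)"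
    and "\<exists>!x. x \<in> carrier_vec p \<and> (G + \<mu> \<cdot>\<^sub>m 1\<^sub>m p) *\<^sub>v x = transpose_mat C *\<^sub>v \<rho>"
    and "\<exists>!y. y \<in> carrier_vec n \<and> (M + \<mu> \<cdot>\<^sub>m 1\<^sub>m n) *\<^sub>v y = \<rho>"
    and "\<lbrakk>x \<in> carrier_vec p; y \<in> carrier_vec n;
          (G + \<mu> \<cdot>\<^sub>m 1\<^sub>m p) *\<^sub>v x = transpose_mat C *\<^sub>v \<rho>; (M + \<mu> \<cdot>\<^sub>m 1\<^sub>m n) *\<^sub>v y = \<rho>\<rbrakk>
         \<Longrightarrow> x = transpose_mat C *\<^sub>v y"
proof -
  let ?T = "transpose_mat C"
  have G: "G \<in> carrier_mat p p" and M: "M \<in> carrier_mat n n"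
    using C Y by (auto simp: G_def M_def)
  have T: "?T \<in> carrier_mat p n" using C by simp
  have Gv0: "G *\<^sub>v x = ?T *\<^sub>v (Y *\<^sub>v (C *\<^sub>v x))" if x: "x \<in> carrier_vec p" for x
    unfolding G_def assoc_mult_mat_vec[OF mult_carrier_mat[OF T Y] C x]
    by (rule assoc_mult_mat_vec[OF T Y mult_mat_vec_carrier[OF C x]])
  have Mv0: "M *\<^sub>v y = Y *\<^sub>v (C *\<^sub>v (?T *\<^sub>v y))" if y: "y \<in> carrier_vec n" for y
    unfolding M_def assoc_mult_mat_vec[OF Y mult_carrier_mat[OF C T] y]
      assoc_mult_mat_vec[OF C T y] ..
  have Gv: "(G + \<mu> \<cdot>\<^sub>m 1\<^sub>m p) *\<^sub>v x = ?T *\<^sub>v (Y *\<^sub>v (C *\<^sub>v x)) + \<mu> \<cdot>\<^sub>v x"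
    if "x \<in> carrier_vec p" for x
    using damped_mult_vec[OF G that] Gv0[OF that] by simp
  have Mv: "(M + \<mu> \<cdot>\<^sub>m 1\<^sub>m n) *\<^sub>v y = Y *\<^sub>v (C *\<^sub>v (?T *\<^sub>v y)) + \<mu> \<cdot>\<^sub>v y"
    if "y \<in> carrier_vec n" for y
    using damped_mult_vec[OF M that] Mv0[OF that] by simp
  have kerG: "x = 0\<^sub>v p" if x: "x \<in> carrier_vec p" and eq: "(G + \<mu> \<cdot>\<^sub>m 1\<^sub>m p) *\<^sub>v x = 0\<^sub>v p" for x
  proof (rule psd_damped_kernel[OF G _ x mu])
    have Cx: "C *\<^sub>v x \<in> carrier_vec n" using C x by simp
    \<comment> \<open>Moving \<open>C^T\<close> across the scalar product turns the form of
      \<open>G\<close> at \<open>x\<close> into the form of \<open>Y\<close> at \<open>C x\<close>,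
      where \<open>psd\<close> applies.\<close>
    have "x \<bullet> (?T *\<^sub>v (Y *\<^sub>v (C *\<^sub>v x))) = (C *\<^sub>v x) \<bullet> (Y *\<^sub>v (C *\<^sub>v x))"
      using transpose_vec_mult_scalar[OF C x, of "Y *\<^sub>v (C *\<^sub>v x)"] C Y x Cx
      by (metis comm_scalar_prod mult_mat_vec_carrier transpose_carrier_mat)
    then show "0 \<le> x \<bullet> (G *\<^sub>v x)"
      using psd[OF Cx] by (simp add: Gv0[OF x])
    show "G *\<^sub>v x + \<mu> \<cdot>\<^sub>v x = 0\<^sub>v p"
      using eq damped_mult_vec[OF G x] by simp
  qed
  \<comment> \<open>Push-through identity: both sides expand to
    \<open>C^T Y C C^T y + \<mu> C^T y\<close>.\<close>
  have push: "?T *\<^sub>v ((M + \<mu> \<cdot>\<^sub>m 1\<^sub>m n) *\<^sub>v y) = (G + \<mu> \<cdot>\<^sub>m 1\<^sub>m p) *\<^sub>v (?T *\<^sub>v y)"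
    if y: "y \<in> carrier_vec n" for y
    using C Y y by (simp add: Mv Gv mult_add_distrib_mat_vec[of _ p n] mult_mat_vec[of _ p n])
  have kerM: "y = 0\<^sub>v n" if y: "y \<in> carrier_vec n" and eq: "(M + \<mu> \<cdot>\<^sub>m 1\<^sub>m n) *\<^sub>v y = 0\<^sub>v n" for y
  proof -
    have "?T *\<^sub>v 0\<^sub>v n = 0\<^sub>v p" using C by (auto intro!: eq_vecI)
    then have "(G + \<mu> \<cdot>\<^sub>m 1\<^sub>m p) *\<^sub>v (?T *\<^sub>v y) = 0\<^sub>v p"
      using push[OF y] unfolding eq by (rule trans[OF sym, rotated])
    then have Ty: "?T *\<^sub>v y = 0\<^sub>v p"
      by (rule kerG[OF mult_mat_vec_carrier[OF T y]])
    have "C *\<^sub>v 0\<^sub>v p = 0\<^sub>v n" using C by (auto intro!: eq_vecI)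
    moreover have "Y *\<^sub>v 0\<^sub>v n = 0\<^sub>v n" using Y by (auto intro!: eq_vecI)
    ultimately have YC0: "Y *\<^sub>v (C *\<^sub>v 0\<^sub>v p) = 0\<^sub>v n" by simp
    \<comment> \<open>With \<open>C^T y = 0\<close> the undamped term disappears and only the
      damping is left.\<close>
    have muy: "\<mu> \<cdot>\<^sub>v y = 0\<^sub>v n" using Mv[OF y] y unfolding eq Ty YC0 by simp
    have "y = (1 / \<mu>) \<cdot>\<^sub>v (\<mu> \<cdot>\<^sub>v y)" using mu by (simp add: smult_smult_assoc)
    also have "\<dots> = 0\<^sub>v n" unfolding muy by auto
    finally show ?thesis .
  qed
  have M': "M + \<mu> \<cdot>\<^sub>m 1\<^sub>m n \<in> carrier_mat n n" and G': "G + \<mu> \<cdot>\<^sub>m 1\<^sub>m p \<in> carrier_mat p p"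
    using M G by auto
  obtain B where "B \<in> carrier_mat n n" "(M + \<mu> \<cdot>\<^sub>m 1\<^sub>m n) * B = 1\<^sub>m n" "B * (M + \<mu> \<cdot>\<^sub>m 1\<^sub>m n) = 1\<^sub>m n"
    using trivial_kernel_imp_inverse[OF M' kerM] by blast
  then show "invertible_mat (M + \<mu> \<cdot>\<^sub>m 1\<^sub>m n)"
    using M' by (auto simp: invertible_mat_def inverts_mat_def intro!: exI[of _ B])
  have Tr: "?T *\<^sub>v \<rho> \<in> carrier_vec p" using C r by simp
  show ex1: "\<exists>!x. x \<in> carrier_vec p \<and> (G + \<mu> \<cdot>\<^sub>m 1\<^sub>m p) *\<^sub>v x = ?T *\<^sub>v \<rho>"
    by (rule trivial_kernel_imp_ex1_solution[OF G' kerG Tr])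
  show "\<exists>!y. y \<in> carrier_vec n \<and> (M + \<mu> \<cdot>\<^sub>m 1\<^sub>m n) *\<^sub>v y = \<rho>"
    by (rule trivial_kernel_imp_ex1_solution[OF M' kerM r])
  show "x = ?T *\<^sub>v y"
    if "x \<in> carrier_vec p" "y \<in> carrier_vec n"
      "(G + \<mu> \<cdot>\<^sub>m 1\<^sub>m p) *\<^sub>v x = ?T *\<^sub>v \<rho>" "(M + \<mu> \<cdot>\<^sub>m 1\<^sub>m n) *\<^sub>v y = \<rho>"
    \<comment> \<open>By \<open>push\<close>, \<open>C^T y\<close> solves the full system, so the
      uniqueness in \<open>ex1\<close> identifies it with \<open>x\<close>.\<close>
    using that push[of y] ex1 T by (metis mult_mat_vec_carrier)
qed

section \<open>Products of horizontal, vertical and diagonal block concatenations\<close>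

lemma append_cols_carrier [simp]:
  "\<lbrakk>A \<in> carrier_mat nr n1; B \<in> carrier_mat nr n2\<rbrakk> \<Longrightarrow> append_cols A B \<in> carrier_mat nr (n1 + n2)"
  unfolding append_cols_def
  using four_block_carrier_mat[of A nr n1 "0\<^sub>m 0 (dim_col B)" 0 n2] by auto

lemma hcat_carrier:
  assumes "\<And>x. x \<in> set xs \<Longrightarrow> A x \<in> carrier_mat nr (n x)"
  shows "hcat nr (map A xs) \<in> carrier_mat nr (\<Sum>x\<leftarrow>xs. n x)"
  using assms by (induction xs) (auto simp: hcat_def)

lemma vcat_carrier:
  assumes "\<And>x. x \<in> set xs \<Longrightarrow> A x \<in> carrier_mat (n x) nc"
  shows "vcat nc (map A xs) \<in> carrier_mat (\<Sum>x\<leftarrow>xs. n x) nc"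
  using assms by (induction xs) (auto simp: vcat_def)

lemma diag_block_mat_carrier:
  assumes "\<And>x. x \<in> set xs \<Longrightarrow> A x \<in> carrier_mat (n x) (p x)"
  shows "diag_block_mat (map A xs) \<in> carrier_mat (\<Sum>x\<leftarrow>xs. n x) (\<Sum>x\<leftarrow>xs. p x)"
  using assms by (induction xs) (auto simp: Let_def)

text \<open>Both concatenations are four-block matrices with empty blocks. In the four-block product
  only the upper left block has entries; the other three have no rows or no columns.\<close>

lemma append_cols_mult_append_rows:
  fixes A :: "real mat"
  assumes "A \<in> carrier_mat nr n1" "A' \<in> carrier_mat nr n2"
    "B \<in> carrier_mat n1 nc" "B' \<in> carrier_mat n2 nc"
  shows "append_cols A A' * append_rows B B' = A * B + A' * B'"
proof -
  have "append_cols A A' * append_rows B B' =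
      four_block_mat (A * B + A' * B') (A * 0\<^sub>m n1 0 + A' * 0\<^sub>m n2 0)
        (0\<^sub>m 0 n1 * B + 0\<^sub>m 0 n2 * B') (0\<^sub>m 0 n1 * 0\<^sub>m n1 0 + 0\<^sub>m 0 n2 * 0\<^sub>m n2 0)"
    unfolding append_cols_def append_rows_def
    using assms by (subst mult_four_block_mat[of _ nr n1 _ n2 _ 0 _ _ nc _ 0]) auto
  also have "\<dots> = A * B + A' * B'"
    using assms by (intro eq_matI) auto
  finally show ?thesis .
qed

text \<open>The zero off-diagonal blocks remove the cross terms, and the lower blocks of the product
  have no rows.\<close>

lemma append_cols_mult_diag_block:
  fixes A :: "real mat"
  assumes "A \<in> carrier_mat nr n1" "A' \<in> carrier_mat nr n2"
    "B \<in> carrier_mat n1 p1" "B' \<in> carrier_mat n2 p2"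
  shows "append_cols A A' * four_block_mat B (0\<^sub>m n1 p2) (0\<^sub>m n2 p1) B' = append_cols (A * B) (A' * B')"
proof -
  have "append_cols A A' * four_block_mat B (0\<^sub>m n1 p2) (0\<^sub>m n2 p1) B' =
      four_block_mat (A * B + A' * 0\<^sub>m n2 p1) (A * 0\<^sub>m n1 p2 + A' * B')
        (0\<^sub>m 0 n1 * B + 0\<^sub>m 0 n2 * 0\<^sub>m n2 p1) (0\<^sub>m 0 n1 * 0\<^sub>m n1 p2 + 0\<^sub>m 0 n2 * B')"
    unfolding append_cols_def
    using assms by (subst mult_four_block_mat[of _ nr n1 _ n2 _ 0 _ _ p1 _ p2]) auto
  also have "\<dots> = append_cols (A * B) (A' * B')"
    unfolding append_cols_def using assms by (intro cong_four_block_mat eq_matI) auto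
  finally show ?thesis .
qed

text \<open>Adds up the operator terms \<open>\<beta>\<close> inside one coordinate block. Stating
  it for entries makes the list sum a sum of reals.\<close>

lemma hcat_mult_vcat_index:
  assumes "\<And>x. x \<in> set xs \<Longrightarrow> A x \<in> carrier_mat nr (n x)"
    and "\<And>x. x \<in> set xs \<Longrightarrow> B x \<in> carrier_mat (n x) nc"
    and ij: "i < nr" "j < nc"
  shows "(hcat nr (map A xs) * vcat nc (map B xs)) $$ (i, j) = (\<Sum>x\<leftarrow>xs. (A x * B x) $$ (i, j))"
  using assms(1,2)
proof (induction xs)
  case Nil
  then show ?case using ij by (simp add: hcat_def vcat_def scalar_prod_def)
next
  case (Cons x xs)
  have A: "A x \<in> carrier_mat nr (n x)" "hcat nr (map A xs) \<in> carrier_mat nr (\<Sum>x\<leftarrow>xs. n x)"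
    and B: "B x \<in> carrier_mat (n x) nc" "vcat nc (map B xs) \<in> carrier_mat (\<Sum>x\<leftarrow>xs. n x) nc"
    using Cons.prems by (auto intro!: hcat_carrier vcat_carrier)
  have "hcat nr (map A (x # xs)) * vcat nc (map B (x # xs)) =
      A x * B x + hcat nr (map A xs) * vcat nc (map B xs)"
    using append_cols_mult_append_rows[OF A B] by (simp add: hcat_def vcat_def)
  moreover have "(hcat nr (map A xs) * vcat nc (map B xs)) $$ (i, j) = (\<Sum>x\<leftarrow>xs. (A x * B x) $$ (i, j))"
    using Cons by simp
  ultimately show ?case using A B ij by simp
qed

text \<open>Combines the coordinates \<open>s\<close>: a block diagonal right factor acts on each
  column block separately.\<close>

lemma hcat_mult_diag_block_mat:
  assumes "\<And>x. x \<in> set xs \<Longrightarrow> A x \<in> carrier_mat nr (n x)"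
    and "\<And>x. x \<in> set xs \<Longrightarrow> B x \<in> carrier_mat (n x) (p x)"
  shows "hcat nr (map A xs) * diag_block_mat (map B xs) = hcat nr (map (\<lambda>x. A x * B x) xs)"
  using assms
proof (induction xs)
  case Nil
  show ?case by (auto simp: hcat_def)
next
  case (Cons x xs)
  have A: "A x \<in> carrier_mat nr (n x)" "hcat nr (map A xs) \<in> carrier_mat nr (\<Sum>x\<leftarrow>xs. n x)"
    and B: "B x \<in> carrier_mat (n x) (p x)"
      "diag_block_mat (map B xs) \<in> carrier_mat (\<Sum>x\<leftarrow>xs. n x) (\<Sum>x\<leftarrow>xs. p x)"
    using Cons.prems by (auto intro!: hcat_carrier diag_block_mat_carrier)
  have "diag_block_mat (map B (x # xs)) =
      four_block_mat (B x) (0\<^sub>m (n x) (\<Sum>x\<leftarrow>xs. p x)) (0\<^sub>m (\<Sum>x\<leftarrow>xs. n x) (p x)) (diag_block_mat (map B xs))"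
    using B by (simp add: Let_def)
  then have "hcat nr (map A (x # xs)) * diag_block_mat (map B (x # xs)) =
      append_cols (A x * B x) (hcat nr (map A xs) * diag_block_mat (map B xs))"
    using append_cols_mult_diag_block[OF A B] by (simp add: hcat_def)
  then show ?case using Cons by (simp add: hcat_def)
qed

section \<open>Pointwise evaluation through continuous representatives\<close>

text \<open>If \<open>g - h\<close> were nonzero at \<open>z\<close>, it would be nonzero on a
  relative neighbourhood of \<open>z\<close> in \<open>K\<close>. By \<open>pos\<close> this
  contains a measurable set of nonzero measure, which cannot lie in a null set.\<close>

lemma continuous_AE_eq_at:
  fixes g h :: "'a::topological_space \<Rightarrow> real"
  assumes g: "continuous_on K g" and h: "continuous_on K h" and ae: "AE x in M. g x = h x"
    and z: "z \<in> K"
    and pos: "\<And>U. open U \<Longrightarrow> z \<in> U \<Longrightarrow> \<exists>A\<in>sets M. A \<subseteq> U \<inter> K \<and> emeasure M A \<noteq> 0"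
  shows "g z = h z"
proof (rule ccontr)
  assume ne: "g z \<noteq> h z"
  have "continuous_on K (\<lambda>x. g x - h x)"
    using g h by (intro continuous_intros)
  then obtain U where U: "open U" "U \<inter> K = (\<lambda>x. g x - h x) -` (- {0}) \<inter> K"
    unfolding continuous_on_open_invariant by (meson open_Compl closed_singleton)
  with z ne have "z \<in> U" by auto
  from pos[OF U(1) this] obtain A where A: "A \<in> sets M" "A \<subseteq> U \<inter> K" "emeasure M A \<noteq> 0"
    by blast
  from ae obtain N where N: "{x \<in> space M. g x \<noteq> h x} \<subseteq> N" "N \<in> sets M" "emeasure M N = 0"
    by (auto elim: AE_E)
  have "A \<subseteq> N"
  proof
    fix x assume x: "x \<in> A"
    with A(2) have "x \<in> U \<inter> K" by blast
    then have "g x \<noteq> h x" unfolding U(2) by simp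
    with x sets.sets_into_space[OF A(1)] N(1) show "x \<in> N" by blast
  qed
  then have "emeasure M A \<le> emeasure M N" using N(2) by (rule emeasure_mono)
  with N(3) A(3) show False by simp
qed

text \<open>The description in \<open>pt_eval\<close> is proper at such a \<open>z\<close>: any two
  continuous representatives agree there.\<close>

lemma pt_eval_eqI:
  assumes g: "continuous_on K g" and ae: "AE x in M. f x = g x" and z: "z \<in> K"
    and pos: "\<And>U. open U \<Longrightarrow> z \<in> U \<Longrightarrow> \<exists>A\<in>sets M. A \<subseteq> U \<inter> K \<and> emeasure M A \<noteq> 0"
  shows "pt_eval M K f z = g z"
  unfolding pt_eval_def
proof (rule the_equality)
  show "\<exists>ga. continuous_on K ga \<and> (AE x in M. f x = ga x) \<and> g z = ga z"
    using g ae by blast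
next
  fix y assume "\<exists>ga. continuous_on K ga \<and> (AE x in M. f x = ga x) \<and> y = ga z"
  then obtain h where h: "continuous_on K h" "AE x in M. f x = h x" "y = h z" by blast
  have "AE x in M. h x = g x" using h(2) ae by eventually_elim simp
  from continuous_AE_eq_at[OF h(1) g this z pos] show "y = g z" using h(3) by simp
qed

section \<open>Neighbourhoods and null sets in intervals and boxes\<close>

lemma product_sigma_finite_interval: "product_sigma_finite (interval_measure_at a b)"
proof (rule product_sigma_finite.intro)
  fix m
  have "finite_measure (interval_measure_at a b m)"
    unfolding interval_measure_at_def
    using emeasure_bounded_finite[of "{a m<..<b m}"]
    by (intro finite_measureI) (simp add: emeasure_restrict_space space_restrict_space less_top)
  then interpret finite_measure "interval_measure_at a b m" .
  show "sigma_finite_measure (interval_measure_at a b m)" by (rule sigma_finite_measure_axioms)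
qed

lemma interval_nbhd_not_null:
  assumes U: "open U" "x \<in> U" and x: "x \<in> {a m<..<b m}"
  shows "\<exists>A\<in>sets (interval_measure_at a b m).
           A \<subseteq> U \<inter> {a m<..<b m} \<and> emeasure (interval_measure_at a b m) A \<noteq> 0"
proof -
  have "open (U \<inter> {a m<..<b m})" "x \<in> U \<inter> {a m<..<b m}" using U x by auto
  then obtain e where e: "e > 0" "ball x e \<subseteq> U \<inter> {a m<..<b m}"
    using open_contains_ball by blast
  have "ball x e = {x - e<..<x + e}" by (auto simp: dist_real_def)
  with e have "emeasure (interval_measure_at a b m) (ball x e) \<noteq> 0" "ball x e \<in> sets (interval_measure_at a b m)"
    by (auto simp: interval_measure_at_def emeasure_restrict_space sets_restrict_space_iff)
  with e(2) show ?thesis by blast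
qed

text \<open>Openness refers to the product topology over all natural numbers, whereas the measure
  lives on functions extensional on \<open>{..<d}\<close>. A basic neighbourhood is shrunk to a box
  of positive factors in the first \<open>d\<close> coordinates; the remaining ones are constant on
  the domain.\<close>

lemma box_nbhd_not_null:
  fixes z :: "nat \<Rightarrow> real"
  assumes U: "open U" "z \<in> U" and z: "z \<in> (\<Pi>\<^sub>E m\<in>{..<d}. {a m<..<b m})"
  shows "\<exists>A\<in>sets (PiM {..<d} (interval_measure_at a b)).
           A \<subseteq> U \<inter> (\<Pi>\<^sub>E m\<in>{..<d}. {a m..b m}) \<and> emeasure (PiM {..<d} (interval_measure_at a b)) A \<noteq> 0"
proof -
  interpret product_sigma_finite "interval_measure_at a b" by (rule product_sigma_finite_interval)
  obtain X where X: "z \<in> Pi\<^sub>E UNIV X" "\<And>i. open (X i)" "Pi\<^sub>E UNIV X \<subseteq> U"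
    using product_topology_open_contains_basis[of "\<lambda>_. euclidean" UNIV U z] U
    by (auto simp: open_fun_def)
  have "\<forall>m\<in>{..<d}. \<exists>A\<in>sets (interval_measure_at a b m).
          A \<subseteq> X m \<inter> {a m<..<b m} \<and> emeasure (interval_measure_at a b m) A \<noteq> 0"
    using X z by (intro ballI interval_nbhd_not_null[of _ "z _"]) auto
  then obtain A where A: "\<And>m. m < d \<Longrightarrow> A m \<in> sets (interval_measure_at a b m)"
    "\<And>m. m < d \<Longrightarrow> A m \<subseteq> X m \<inter> {a m<..<b m}"
    "\<And>m. m < d \<Longrightarrow> emeasure (interval_measure_at a b m) (A m) \<noteq> 0"
    by (metis lessThan_iff)
  have "x m \<in> X m" if x: "x \<in> Pi\<^sub>E {..<d} A" for x m
  proof (cases "m < d")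
    case True
    then show ?thesis using PiE_mem[OF x, of m] A(2)[of m] by auto
  next
    case False
    \<comment> \<open>Outside \<open>{..<d}\<close> both points take the value
      \<open>undefined\<close>, so the constraint \<open>X m\<close> holds for \<open>x\<close>
      because it holds for \<open>z\<close>.\<close>
    then have "x m = z m" using PiE_arb[OF x, of m] PiE_arb[OF z, of m] by simp
    with X(1) show ?thesis by auto
  qed
  then have "Pi\<^sub>E {..<d} A \<subseteq> U" using X(3) by blast
  moreover have "Pi\<^sub>E {..<d} A \<subseteq> (\<Pi>\<^sub>E m\<in>{..<d}. {a m..b m})"
    using A(2) by (intro PiE_mono) (auto simp: subset_eq less_imp_le)
  moreover have "emeasure (PiM {..<d} (interval_measure_at a b)) (Pi\<^sub>E {..<d} A) \<noteq> 0"
    using A by (subst emeasure_PiM) auto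
  moreover have "Pi\<^sub>E {..<d} A \<in> sets (PiM {..<d} (interval_measure_at a b))"
    using A(1) by (intro sets_PiM_I_finite) auto
  ultimately show ?thesis by (intro bexI[of _ "Pi\<^sub>E {..<d} A"] conjI Int_greatest)
qed

text \<open>The exceptional set lies in a cylinder over a null set; its measure is a product with a
  zero factor, hence zero even if other factors are infinite.\<close>

lemma (in product_sigma_finite) AE_PiM_component_finite:
  assumes I: "finite I" "i \<in> I" and ae: "AE x in M i. P x"
  shows "AE z in PiM I M. P (z i)"
proof -
  from ae obtain N where N: "{x \<in> space (M i). \<not> P x} \<subseteq> N" "N \<in> sets (M i)" "emeasure (M i) N = 0"
    by (auto elim: AE_E)
  let ?B = "\<lambda>j. if j = i then N else space (M j)"
  have "emeasure (PiM I M) (Pi\<^sub>E I ?B) = (\<Prod>j\<in>I. emeasure (M j) (?B j))"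
    using I N(2) by (intro emeasure_PiM) auto
  also have "\<dots> = 0" using I N(3) by (intro prod_zero) auto
  finally have "emeasure (PiM I M) (Pi\<^sub>E I ?B) = 0" .
  moreover have "Pi\<^sub>E I ?B \<in> sets (PiM I M)" using I N(2) by (intro sets_PiM_I_finite) auto
  moreover have "{z \<in> space (PiM I M). \<not> P (z i)} \<subseteq> Pi\<^sub>E I ?B"
    using N(1) I by (auto simp: space_PiM PiE_iff extensional_def)
  ultimately show ?thesis by (intro AE_I)
qed

section \<open>Derivatives and bounded operators on Hilbert function spaces\<close>

lemma bounded_operator_L2:
  "\<lbrakk>bounded_operator X N T; f \<in> carr X\<rbrakk> \<Longrightarrow> T f \<in> carr (L2 N)"
  by (simp add: bounded_operator_def)

lemma bounded_operator_add:
  "\<lbrakk>bounded_operator X N T; f \<in> carr X; g \<in> carr X\<rbrakk> \<Longrightarrow> AE y in N. T (\<lambda>x. f x + g x) y = T f y + T g y"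
  by (simp add: bounded_operator_def)

lemma bounded_operator_scale:
  "\<lbrakk>bounded_operator X N T; f \<in> carr X\<rbrakk> \<Longrightarrow> AE y in N. T (\<lambda>x. r * f x) y = r * T f y"
  by (simp add: bounded_operator_def)

text \<open>The property by which \<open>curve_deriv\<close> chooses its value. A predicate is
  convenient because the derivative is determined only up to norm zero.\<close>

definition has_curve_deriv :: "'a fspace \<Rightarrow> (real \<Rightarrow> 'a \<Rightarrow> real) \<Rightarrow> ('a \<Rightarrow> real) \<Rightarrow> bool" where
  "has_curve_deriv X F D \<longleftrightarrow>
     D \<in> carr X \<and> ((\<lambda>t. fnorm X (\<lambda>x. (F t x - F 0 x) / t - D x)) \<longlongrightarrow> 0) (at 0)"

context hilbert_function_space
begin

lemma diff_mem: "\<lbrakk>f \<in> carr X; g \<in> carr X\<rbrakk> \<Longrightarrow> (\<lambda>x. f x - g x) \<in> carr X"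
  using add_mem[of f "\<lambda>x. -1 * g x"] scale_mem[of g "-1"] by simp

lemma sum_mem: "\<lbrakk>finite A; \<And>i. i \<in> A \<Longrightarrow> F i \<in> carr X\<rbrakk> \<Longrightarrow> (\<lambda>x. \<Sum>i\<in>A. F i x) \<in> carr X"
  by (induction A rule: finite_induct) (auto intro: zero_mem add_mem)

lemma fnorm_nonneg: "f \<in> carr X \<Longrightarrow> 0 \<le> fnorm X f"
  by (simp add: fnorm_def ip_nonneg)

lemma fnorm_zero: "fnorm X (\<lambda>_. 0) = 0"
  using ip_zero_iff[OF zero_mem] by (simp add: fnorm_def)

lemma fnorm_scale:
  assumes "f \<in> carr X" shows "fnorm X (\<lambda>x. r * f x) = \<bar>r\<bar> * fnorm X f"
proof -
  have "ip X (\<lambda>x. r * f x) (\<lambda>x. r * f x) = r\<^sup>2 * ip X f f"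
    using ip_scale[OF assms scale_mem[OF assms], of r r] ip_scale[OF assms assms, of r]
      ip_sym[OF assms scale_mem[OF assms], of r] by (simp add: power2_eq_square)
  then show ?thesis by (simp add: fnorm_def real_sqrt_mult)
qed

lemma ip_add_self:
  assumes "f \<in> carr X" "g \<in> carr X"
  shows "ip X (\<lambda>x. f x + g x) (\<lambda>x. f x + g x) = ip X f f + 2 * ip X f g + ip X g g"
proof -
  let ?h = "\<lambda>x. f x + g x"
  have h: "?h \<in> carr X" using assms by (rule add_mem)
  have "ip X ?h ?h = ip X ?h f + ip X ?h g"
    using ip_add[OF assms h] ip_sym[OF assms(1) h] ip_sym[OF assms(2) h] by simp
  also have "\<dots> = ip X f f + 2 * ip X f g + ip X g g"
    using ip_add[OF assms assms(1)] ip_add[OF assms assms(2)] ip_sym[OF assms] by simp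
  finally show ?thesis .
qed

text \<open>The factor 2 spares the Cauchy-Schwarz inequality: limits only need a quasi-norm.\<close>

lemma fnorm_add_le:
  assumes f: "f \<in> carr X" and g: "g \<in> carr X"
  shows "fnorm X (\<lambda>x. f x + g x) \<le> 2 * (fnorm X f + fnorm X g)"
proof -
  have g': "(\<lambda>x. -1 * g x) \<in> carr X" using g by (rule scale_mem)
  \<comment> \<open>Nonnegativity of the squared norm of \<open>f - g\<close> bounds the mixed term.
    The difference is written with \<open>-1 * g x\<close> so that \<open>ip_add_self\<close> and
    \<open>ip_scale\<close> match.\<close>
  have "0 \<le> ip X (\<lambda>x. f x + -1 * g x) (\<lambda>x. f x + -1 * g x)"
    using f g' by (intro ip_nonneg add_mem)
  also have "\<dots> = ip X f f - 2 * ip X f g + ip X g g"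
    using ip_add_self[OF f g'] f g g' by (simp only: ip_sym[OF f g'] ip_scale ip_sym[OF g g'] ip_sym[OF g f])
  finally have "ip X (\<lambda>x. f x + g x) (\<lambda>x. f x + g x) \<le> 2 * (ip X f f + ip X g g)"
    using ip_add_self[OF f g] by simp
  also have "\<dots> = 2 * ((fnorm X f)\<^sup>2 + (fnorm X g)\<^sup>2)"
    using f g by (simp add: fnorm_def ip_nonneg)
  also have "\<dots> \<le> (2 * (fnorm X f + fnorm X g))\<^sup>2"
  proof -
    have "0 \<le> fnorm X f * fnorm X g" "0 \<le> (fnorm X f)\<^sup>2" "0 \<le> (fnorm X g)\<^sup>2"
      using fnorm_nonneg[OF f] fnorm_nonneg[OF g] by auto
    then show ?thesis by (simp add: power2_eq_square algebra_simps)
  qed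
  finally show ?thesis
    unfolding fnorm_def[of X "\<lambda>x. f x + g x"]
    using fnorm_nonneg[OF f] fnorm_nonneg[OF g] by (intro real_le_lsqrt) auto
qed

lemma tendsto_fnorm_add:
  assumes mem: "\<And>t. F t \<in> carr X" "\<And>t. G t \<in> carr X"
    and lim: "((\<lambda>t. fnorm X (F t)) \<longlongrightarrow> 0) net" "((\<lambda>t. fnorm X (G t)) \<longlongrightarrow> 0) net"
  shows "((\<lambda>t. fnorm X (\<lambda>x. F t x + G t x)) \<longlongrightarrow> 0) net"
proof (rule tendsto_sandwich)
  show "\<forall>\<^sub>F t in net. 0 \<le> fnorm X (\<lambda>x. F t x + G t x)"
    using mem by (intro always_eventually allI fnorm_nonneg add_mem)
  show "\<forall>\<^sub>F t in net. fnorm X (\<lambda>x. F t x + G t x) \<le> 2 * (fnorm X (F t) + fnorm X (G t))"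
    using mem by (intro always_eventually allI fnorm_add_le)
  show "((\<lambda>t. 2 * (fnorm X (F t) + fnorm X (G t))) \<longlongrightarrow> 0) net"
    using tendsto_mult_left[OF tendsto_add[OF lim], of 2] by simp
qed simp

lemma tendsto_fnorm_sum:
  assumes "finite A" "\<And>i t. i \<in> A \<Longrightarrow> F i t \<in> carr X"
    and "\<And>i. i \<in> A \<Longrightarrow> ((\<lambda>t. fnorm X (F i t)) \<longlongrightarrow> 0) net"
  shows "((\<lambda>t. fnorm X (\<lambda>x. \<Sum>i\<in>A. F i t x)) \<longlongrightarrow> 0) net"
  using assms
proof (induction A rule: finite_induct)
  case empty
  then show ?case by (simp add: fnorm_zero)
next
  case (insert i A)
  then show ?case
    using tendsto_fnorm_add[of "F i" "\<lambda>t x. \<Sum>i\<in>A. F i t x" net] by (simp add: sum_mem)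
qed

lemma has_curve_deriv_curve_deriv:
  "has_curve_deriv X F D \<Longrightarrow> has_curve_deriv X F (curve_deriv X F)"
  unfolding has_curve_deriv_def curve_deriv_def
  by (rule someI[where P = "\<lambda>D. D \<in> carr X \<and> (_ D \<longlongrightarrow> 0) (at 0)"])

text \<open>Division by zero yields zero, so membership holds at \<open>t = 0\<close> as well and
  later limits need no case distinction.\<close>

lemma quotient_mem:
  assumes "\<And>t. F t \<in> carr X" "D \<in> carr X"
  shows "(\<lambda>x. (F t x - F 0 x) / t - D x) \<in> carr X"
  using diff_mem[OF scale_mem[OF diff_mem[OF assms(1) assms(1)]] assms(2), of "1 / t" t 0] by simp

text \<open>\<open>D - E\<close> is the difference of the two error quotients, which tends to zero
  while not depending on \<open>t\<close>.\<close>

lemma has_curve_deriv_unique: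
  assumes F: "\<And>t. F t \<in> carr X" and D: "has_curve_deriv X F D" and E: "has_curve_deriv X F E"
  shows "fnorm X (\<lambda>x. D x - E x) = 0"
proof -
  let ?q = "\<lambda>D t x. (F t x - F 0 x) / t - D x"
  have mem: "D \<in> carr X" "E \<in> carr X" using D E by (auto simp: has_curve_deriv_def)
  note q = quotient_mem[where F = F, OF F]
  have limD: "((\<lambda>t. fnorm X (\<lambda>x. -1 * ?q D t x)) \<longlongrightarrow> 0) (at 0)"
    using D mem by (subst fnorm_scale[OF q]) (auto simp: has_curve_deriv_def)
  have "((\<lambda>t. fnorm X (\<lambda>x. -1 * ?q D t x + ?q E t x)) \<longlongrightarrow> 0) (at 0)"
    by (rule tendsto_fnorm_add[OF scale_mem[OF q] q limD])
      (use E mem in \<open>auto simp: has_curve_deriv_def\<close>)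
  moreover have "(\<lambda>x. -1 * ?q D t x + ?q E t x) = (\<lambda>x. D x - E x)" for t by auto
  ultimately have "((\<lambda>t::real. fnorm X (\<lambda>x. D x - E x)) \<longlongrightarrow> 0) (at 0)" by simp
  then show ?thesis by (simp add: tendsto_const_iff)
qed

text \<open>Along \<open>h = t e_j\<close> the length of \<open>h\<close> is
  \<open>\<bar>t\<bar>\<close> and the linear part reduces to \<open>t * D j\<close>, so the Frechet
  estimate divided by \<open>\<bar>t\<bar>\<close> is the required limit.\<close>

lemma frechet_differentiable_imp_has_curve_deriv:
  assumes fr: "frechet_differentiable X p F v" and F: "\<And>v. v \<in> carrier_vec p \<Longrightarrow> F v \<in> carr X"
    and v: "v \<in> carrier_vec p" and j: "j < p"
  shows "\<exists>D. has_curve_deriv X (\<lambda>t. F (v + t \<cdot>\<^sub>v unit_vec p j)) D"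
proof -
  from fr obtain D where D: "\<And>j. j < p \<Longrightarrow> D j \<in> carr X"
    and lim: "\<And>e. e > 0 \<Longrightarrow> \<exists>r>0. \<forall>h\<in>carrier_vec p. sqrt (h \<bullet> h) < r \<longrightarrow>
           fnorm X (\<lambda>x. F (v + h) x - F v x - (\<Sum>j<p. h $ j * D j x)) \<le> e * sqrt (h \<bullet> h)"
    unfolding frechet_differentiable_def by blast
  let ?h = "\<lambda>t. t \<cdot>\<^sub>v unit_vec p j :: real Matrix.vec"
  let ?F = "\<lambda>t. F (v + ?h t)"
  have h: "?h t \<in> carrier_vec p" for t by simp
  have Fmem: "?F t \<in> carr X" for t using v by (intro F) simp
  have F0: "?F 0 = F v" using v by (intro arg_cong[of _ _ F]) auto
  have hh: "sqrt (?h t \<bullet> ?h t) = \<bar>t\<bar>" for t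
    using j by (simp add: power2_eq_square[symmetric])
  have hD: "(\<Sum>i<p. ?h t $ i * D i x) = t * D j x" for t x
  proof -
    have "(\<Sum>i<p. ?h t $ i * D i x) = (\<Sum>i<p. if i = j then t * D j x else 0)"
      using j by (intro sum.cong) auto
    then show ?thesis using j by simp
  qed
  have "((\<lambda>t. fnorm X (\<lambda>x. (?F t x - ?F 0 x) / t - D j x)) \<longlongrightarrow> 0) (at 0)"
  proof (rule tendstoI)
    fix e :: real assume e: "e > 0"
    \<comment> \<open>Halving \<open>e\<close> turns the weak Frechet bound into the strict one
      demanded by \<open>tendstoI\<close>.\<close>
    from lim[of "e / 2"] e obtain r where r: "r > 0"
      "\<And>h. h \<in> carrier_vec p \<Longrightarrow> sqrt (h \<bullet> h) < r \<Longrightarrow>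
           fnorm X (\<lambda>x. F (v + h) x - F v x - (\<Sum>j<p. h $ j * D j x)) \<le> e / 2 * sqrt (h \<bullet> h)"
      by auto
    have "dist (fnorm X (\<lambda>x. (?F t x - ?F 0 x) / t - D j x)) 0 < e" if t: "t \<noteq> 0" "\<bar>t\<bar> < r" for t
    proof -
      let ?q = "\<lambda>x. (?F t x - ?F 0 x) / t - D j x"
      have q: "?q \<in> carr X" using quotient_mem[of ?F "D j", OF Fmem D[OF j]] .
      have "\<bar>t\<bar> * fnorm X ?q = fnorm X (\<lambda>x. t * ?q x)" by (simp add: fnorm_scale[OF q])
      also have "(\<lambda>x. t * ?q x) = (\<lambda>x. F (v + ?h t) x - F v x - (\<Sum>i<p. ?h t $ i * D i x))"
        unfolding hD F0 using t by (simp add: fun_eq_iff field_simps)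
      also have "fnorm X \<dots> \<le> e / 2 * \<bar>t\<bar>"
        using r(2)[OF h[of t]] t unfolding hh by simp
      finally have "fnorm X ?q \<le> e / 2" using t by (simp add: mult.commute)
      with e fnorm_nonneg[OF q] show ?thesis by simp
    qed
    then show "\<forall>\<^sub>F t in at 0. dist (fnorm X (\<lambda>x. (?F t x - ?F 0 x) / t - D j x)) 0 < e"
      using r(1) by (auto simp: eventually_at dist_real_def)
  qed
  with D[OF j] have "has_curve_deriv X ?F (D j)" unfolding has_curve_deriv_def by simp
  then show ?thesis by blast
qed

text \<open>Boundedness sends a difference of norm zero to an element of \<open>L2\<close> norm
  zero, that is, to a null function; additivity applied to \<open>f = (f - g) + g\<close>
  finishes.\<close>

lemma bounded_operator_AE_cong:
  assumes T: "bounded_operator X N T" and f: "f \<in> carr X" and g: "g \<in> carr X"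
    and eq: "fnorm X (\<lambda>x. f x - g x) = 0"
  shows "AE y in N. T f y = T g y"
proof -
  let ?h = "\<lambda>x. f x - g x"
  have h: "?h \<in> carr X" by (rule diff_mem[OF f g])
  have "fnorm (L2 N) (T ?h) \<le> 0"
    using T h eq unfolding bounded_operator_def by (metis mult_zero_right)
  then have "(\<integral>y. (T ?h y)\<^sup>2 \<partial>N) \<le> 0" by (simp add: fnorm_def L2_def power2_eq_square)
  moreover have "integrable N (\<lambda>y. (T ?h y)\<^sup>2)"
    using bounded_operator_L2[OF T h] by (simp add: L2_def)
  ultimately have "AE y in N. (T ?h y)\<^sup>2 = 0"
    using integral_nonneg_eq_0_iff_AE[of N "\<lambda>y. (T ?h y)\<^sup>2"] Bochner_Integration.integral_nonneg[of N "\<lambda>y. (T ?h y)\<^sup>2"]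
    by (simp add: antisym)
  moreover have "AE y in N. T (\<lambda>x. ?h x + g x) y = T ?h y + T g y"
    by (rule bounded_operator_add[OF T h g])
  ultimately show ?thesis by eventually_elim simp
qed

lemma bounded_operator_sum:
  assumes T: "bounded_operator X N T" and A: "finite A" and f: "\<And>i. i \<in> A \<Longrightarrow> f i \<in> carr X"
  shows "AE y in N. T (\<lambda>x. \<Sum>i\<in>A. c i * f i x) y = (\<Sum>i\<in>A. c i * T (f i) y)"
  using A f
proof (induction A rule: finite_induct)
  case empty
  \<comment> \<open>Homogeneity with factor \<open>0\<close> gives the value at the zero
    function.\<close>
  show ?case using bounded_operator_scale[OF T zero_mem, of 0] by simp
next
  case (insert i A)
  have "AE y in N. T (\<lambda>x. c i * f i x + (\<Sum>i\<in>A. c i * f i x)) y =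
      T (\<lambda>x. c i * f i x) y + T (\<lambda>x. \<Sum>i\<in>A. c i * f i x) y"
    using insert.prems insert.hyps by (intro bounded_operator_add[OF T] scale_mem sum_mem) auto
  moreover have "AE y in N. T (\<lambda>x. c i * f i x) y = c i * T (f i) y"
    using insert.prems by (intro bounded_operator_scale[OF T]) simp
  moreover have "AE y in N. T (\<lambda>x. \<Sum>i\<in>A. c i * f i x) y = (\<Sum>i\<in>A. c i * T (f i) y)"
    using insert by simp
  ultimately show ?case
    by eventually_elim (use insert in simp)
qed

end

section \<open>Derivatives of sums of elementary tensors\<close>

lemma sum_list_upt: "(\<Sum>x\<leftarrow>[0..<n]. f x) = (\<Sum>x<n. f x :: nat)"
  by (simp add: interv_sum_list_conv_sum_set_nat atLeast0LessThan)

lemma in_multi_indices: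
  assumes "a \<in> set (multi_indices d N)"
  shows "length a = d" "m < d \<Longrightarrow> a ! m < N m"
proof -
  have "list_all2 (\<lambda>x ys. x \<in> set ys) a (map (\<lambda>m. [0..<N m]) [0..<d])"
    using assms by (simp add: multi_indices_def product_lists_set)
  then show "length a = d" "m < d \<Longrightarrow> a ! m < N m"
    by (auto simp: list_all2_conv_all_nth)
qed

lemma length_multi_indices: "length (multi_indices d N) = (\<Prod>m<d. N m)"
proof -
  have len: "length (product_lists xss) = prod_list (map length xss)" for xss :: "nat list list"
    by (induction xss) (simp_all add: length_concat o_def sum_list_triv)
  show ?thesis
    unfolding multi_indices_def len
    by (simp add: o_def prod.distinct_set_conv_list[symmetric] atLeast0LessThan)
qed

text \<open>Isolating factor \<open>s\<close> exhibits linearity in that slot, which is what the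
  difference quotient needs.\<close>

lemma tensor_fun_upd:
  assumes "s < d"
  shows "tensor d (v(s := f)) z = f (z s) * (\<Prod>m\<in>{..<d} - {s}. v m (z m))"
  unfolding tensor_def using assms by (subst prod.remove[of _ s]) (auto intro!: prod.cong)

lemma fnorm_tensor:
  assumes "hilbert_tensor_product d M Hm H" "\<And>m. m < d \<Longrightarrow> v m \<in> carr (Hm m)"
  shows "fnorm H (tensor d v) = (\<Prod>m<d. fnorm (Hm m) (v m))"
proof -
  have "sqrt (\<Prod>m<d. ip (Hm m) (v m) (v m)) = (\<Prod>m<d. sqrt (ip (Hm m) (v m) (v m)))"
    by (induction d) (simp_all add: real_sqrt_mult)
  then show ?thesis using assms unfolding hilbert_tensor_product_def fnorm_def by simp
qed

lemma fnorm_tensor_fun_upd: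
  assumes "hilbert_tensor_product d M Hm H" "s < d"
    "\<And>m. m < d \<Longrightarrow> m \<noteq> s \<Longrightarrow> v m \<in> carr (Hm m)" "f \<in> carr (Hm s)"
  shows "fnorm H (tensor d (v(s := f))) = fnorm (Hm s) f * (\<Prod>m\<in>{..<d} - {s}. fnorm (Hm m) (v m))"
proof -
  have "fnorm H (tensor d (v(s := f))) = (\<Prod>m<d. fnorm (Hm m) ((v(s := f)) m))"
    using assms by (intro fnorm_tensor) auto
  then show ?thesis
    using assms(2) by (subst (asm) prod.remove[of _ s]) (auto intro!: prod.cong)
qed

text \<open>Only slot \<open>s\<close> moves with \<open>t\<close>. By linearity there, the error of
  the quotient is again a sum of tensors, with the one-dimensional error in slot \<open>s\<close>;
  multiplicativity of the norm makes each summand tend to zero.\<close>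

lemma has_curve_deriv_tensor_sum:
  assumes H: "hilbert_tensor_product d M Hm H" and s: "s < d" and fin: "finite I"
    and Hs: "hilbert_function_space (M s) (Hm s)"
    and v: "\<And>i m. i \<in> I \<Longrightarrow> m < d \<Longrightarrow> m \<noteq> s \<Longrightarrow> v i m \<in> carr (Hm m)"
    and W: "\<And>i t. i \<in> I \<Longrightarrow> W i t \<in> carr (Hm s)"
    and D: "\<And>i. i \<in> I \<Longrightarrow> has_curve_deriv (Hm s) (W i) (D i)"
  shows "has_curve_deriv H (\<lambda>t z. \<Sum>i\<in>I. c i * tensor d ((v i)(s := W i t)) z)
           (\<lambda>z. \<Sum>i\<in>I. c i * tensor d ((v i)(s := D i)) z)"
proof -
  interpret H: hilbert_function_space "PiM {..<d} M" H
    using H by (simp add: hilbert_tensor_product_def)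
  interpret Hs: hilbert_function_space "M s" "Hm s" by (rule Hs)
  have tensor_mem: "tensor d ((v i)(s := f)) \<in> carr H" if "i \<in> I" "f \<in> carr (Hm s)" for i f
    using H v[OF that(1)] that(2) by (simp add: hilbert_tensor_product_def)
  have Dm: "D i \<in> carr (Hm s)" if "i \<in> I" for i using D[OF that] by (simp add: has_curve_deriv_def)
  let ?q = "\<lambda>i t x. (W i t x - W i 0 x) / t - D i x"
  have q: "?q i t \<in> carr (Hm s)" if "i \<in> I" for i t
    by (rule Hs.quotient_mem) (use W Dm that in auto)
  have quot: "((\<Sum>i\<in>I. c i * tensor d ((v i)(s := W i t)) z) - (\<Sum>i\<in>I. c i * tensor d ((v i)(s := W i 0)) z)) / t
      - (\<Sum>i\<in>I. c i * tensor d ((v i)(s := D i)) z) = (\<Sum>i\<in>I. c i * tensor d ((v i)(s := ?q i t)) z)" for t z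
    unfolding sum_subtractf[symmetric] sum_divide_distrib
    by (intro sum.cong refl) (simp add: tensor_fun_upd[OF s] algebra_simps diff_divide_distrib)
  have "((\<lambda>t. fnorm H (\<lambda>z. \<Sum>i\<in>I. c i * tensor d ((v i)(s := ?q i t)) z)) \<longlongrightarrow> 0) (at 0)"
  proof (rule H.tendsto_fnorm_sum[OF fin])
    fix i t assume "i \<in> I"
    then show "(\<lambda>z. c i * tensor d ((v i)(s := ?q i t)) z) \<in> carr H"
      by (intro H.scale_mem tensor_mem q)
  next
    fix i assume i: "i \<in> I"
    let ?P = "\<Prod>m\<in>{..<d} - {s}. fnorm (Hm m) (v i m)"
    have "fnorm H (\<lambda>z. c i * tensor d ((v i)(s := ?q i t)) z) = \<bar>c i\<bar> * (fnorm (Hm s) (?q i t) * ?P)" for t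
      using H.fnorm_scale[OF tensor_mem[OF i q[OF i]]]
        fnorm_tensor_fun_upd[OF H s v[OF i] q[OF i]] by simp
    moreover have "((\<lambda>t. \<bar>c i\<bar> * (fnorm (Hm s) (?q i t) * ?P)) \<longlongrightarrow> \<bar>c i\<bar> * (0 * ?P)) (at 0)"
      using D[OF i] unfolding has_curve_deriv_def by (intro tendsto_intros) auto
    ultimately show "((\<lambda>t. fnorm H (\<lambda>z. c i * tensor d ((v i)(s := ?q i t)) z)) \<longlongrightarrow> 0) (at 0)"
      by simp
  qed
  moreover have "(\<lambda>z. \<Sum>i\<in>I. c i * tensor d ((v i)(s := D i)) z) \<in> carr H"
    using fin Dm by (intro H.sum_mem H.scale_mem tensor_mem)
  ultimately show ?thesis unfolding has_curve_deriv_def quot by blast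
qed

section \<open>Factorization of the Jacobian\<close>

context separable_setting
begin

abbreviation "d \<equiv> dim_total S"

abbreviation "core_indices \<equiv> set (multi_indices d (num_basis S))"

text \<open>Only factor \<open>s\<close> depends on the block \<open>\<theta> s\<close>, so the
  product rule leaves one term per multi-index, with these factors.\<close>

abbreviation "partial_factor s j a \<equiv>
  (\<lambda>m. basis S m (a ! m) (\<theta> m))(s := partial_basis S \<theta> s j (a ! s))"

lemma H_hilbert: "hilbert_function_space (domain_M S) (H_space S)"
  using H_tensor by (simp add: hilbert_tensor_product_def domain_M_def)

lemma shifted_param: "s < d \<Longrightarrow> \<theta> s + t \<cdot>\<^sub>v unit_vec (num_par S s) j \<in> carrier_vec (num_par S s)"
  using theta_dim by simp

lemma partial_basis_deriv:
  assumes "s < d" "j < num_par S s" "b < num_basis S s"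
  shows "has_curve_deriv (H_factor S s) (\<lambda>t. basis S s b (\<theta> s + t \<cdot>\<^sub>v unit_vec (num_par S s) j))
           (partial_basis S \<theta> s j b)"
proof -
  interpret hilbert_function_space "interval_M S s" "H_factor S s" using assms by (intro Hm_hilbert)
  have "\<exists>D. has_curve_deriv (H_factor S s) (\<lambda>t. basis S s b (\<theta> s + t \<cdot>\<^sub>v unit_vec (num_par S s) j)) D"
    using assms by (intro frechet_differentiable_imp_has_curve_deriv basis_diff basis_mem theta_dim)
  then show ?thesis unfolding partial_basis_def using has_curve_deriv_curve_deriv by blast
qed

lemma partial_factor_mem:
  assumes "s < d" "j < num_par S s" "a \<in> core_indices" "m < d"
  shows "partial_factor s j a m \<in> carr (H_factor S m)"
  using assms partial_basis_deriv[of s j "a ! s"] basis_mem theta_dim in_multi_indices(2)[of a]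
  by (auto simp: has_curve_deriv_def)

lemma partial_u_deriv:
  assumes s: "s < d" and j: "j < num_par S s"
  shows "has_curve_deriv (H_space S) (\<lambda>t. u_net S (\<theta>(s := \<theta> s + t \<cdot>\<^sub>v unit_vec (num_par S s) j)))
           (\<lambda>z. \<Sum>a\<in>core_indices. core S a * tensor d (partial_factor s j a) z)"
proof -
  let ?v = "\<lambda>a m. basis S m (a ! m) (\<theta> m)"
  let ?W = "\<lambda>a t. basis S s (a ! s) (\<theta> s + t \<cdot>\<^sub>v unit_vec (num_par S s) j)"
  have "(\<lambda>m. basis S m (a ! m) ((\<theta>(s := \<theta> s + t \<cdot>\<^sub>v unit_vec (num_par S s) j)) m)) = (?v a)(s := ?W a t)" for a t
    by auto
  then have "u_net S (\<theta>(s := \<theta> s + t \<cdot>\<^sub>v unit_vec (num_par S s) j)) =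
      (\<lambda>z. \<Sum>a\<in>core_indices. core S a * tensor d ((?v a)(s := ?W a t)) z)" for t
    unfolding u_net_def by simp
  then show ?thesis
    using s j
    by (simp only:) (intro has_curve_deriv_tensor_sum[OF H_tensor s finite_set Hm_hilbert[OF s]]
        partial_basis_deriv basis_mem shifted_param theta_dim in_multi_indices(2))
qed

text \<open>\<open>partial_u\<close> is a choice known only up to norm zero in
  \<open>H_space S\<close>. Each bounded \<open>T \<beta>\<close> ignores this ambiguity, so the
  explicit tensor sum can replace it, and \<open>T \<beta>\<close> then acts factorwise.\<close>

lemma op_A_partial_u_AE:
  assumes s: "s < d" and j: "j < num_par S s"
  shows "AE z in domain_M S. op_A S (partial_u S \<theta> s j) z =
    (\<Sum>\<beta><op_rank S. \<Sum>a\<in>core_indices. core S a *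
       tensor d (\<lambda>m. op_factor S \<beta> m (partial_factor s j a m)) z)"
proof -
  interpret H: hilbert_function_space "domain_M S" "H_space S" by (rule H_hilbert)
  let ?F = "\<lambda>t. u_net S (\<theta>(s := \<theta> s + t \<cdot>\<^sub>v unit_vec (num_par S s) j))"
  let ?D = "\<lambda>z. \<Sum>a\<in>core_indices. core S a * tensor d (partial_factor s j a) z"
  obtain T where T: "\<And>\<beta>. \<beta> < op_rank S \<Longrightarrow> tensor_operator d (interval_M S) (H_factor S) (H_space S) (op_factor S \<beta>) (T \<beta>)"
    and A: "\<And>h. h \<in> carr (H_space S) \<Longrightarrow> AE z in domain_M S. op_A S h z = (\<Sum>\<beta><op_rank S. T \<beta> h z)"
    using A_separable by blast
  have tensor_mem: "tensor d v \<in> carr (H_space S)" if "\<And>m. m < d \<Longrightarrow> v m \<in> carr (H_factor S m)" for v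
    using H_tensor that by (simp add: hilbert_tensor_product_def)
  have tm: "tensor d (partial_factor s j a) \<in> carr (H_space S)" if "a \<in> core_indices" for a
    by (intro tensor_mem partial_factor_mem s j that)
  have Fmem: "?F t \<in> carr (H_space S)" for t
    unfolding u_net_def using s
    by (intro H.sum_mem H.scale_mem tensor_mem basis_mem finite_set in_multi_indices(2))
      (auto simp: theta_dim)
  have D': "has_curve_deriv (H_space S) ?F (partial_u S \<theta> s j)"
    unfolding partial_u_def by (rule H.has_curve_deriv_curve_deriv[OF partial_u_deriv[OF s j]])
  have mem: "?D \<in> carr (H_space S)" "partial_u S \<theta> s j \<in> carr (H_space S)"
    using partial_u_deriv[OF s j] D' by (auto simp: has_curve_deriv_def)
  have eq: "fnorm (H_space S) (\<lambda>z. partial_u S \<theta> s j z - ?D z) = 0"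
    by (rule H.has_curve_deriv_unique[OF Fmem D' partial_u_deriv[OF s j]])
  have "AE z in domain_M S. T \<beta> (partial_u S \<theta> s j) z = (\<Sum>a\<in>core_indices. core S a *
       tensor d (\<lambda>m. op_factor S \<beta> m (partial_factor s j a m)) z)" if b: "\<beta> < op_rank S" for \<beta>
  proof -
    have bdd: "bounded_operator (H_space S) (domain_M S) (T \<beta>)"
      and elem: "\<And>v. (\<And>m. m < d \<Longrightarrow> v m \<in> carr (H_factor S m)) \<Longrightarrow>
        AE z in domain_M S. T \<beta> (tensor d v) z = tensor d (\<lambda>m. op_factor S \<beta> m (v m)) z"
      using T[OF b] unfolding tensor_operator_def domain_M_def by blast+
    have "AE z in domain_M S. T \<beta> (partial_u S \<theta> s j) z = T \<beta> ?D z"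
      by (rule H.bounded_operator_AE_cong[OF bdd mem(2,1) eq])
    moreover have "AE z in domain_M S. T \<beta> ?D z = (\<Sum>a\<in>core_indices. core S a * T \<beta> (tensor d (partial_factor s j a)) z)"
      by (rule H.bounded_operator_sum[OF bdd finite_set tm])
    \<comment> \<open>Finitely many null sets, one per multi-index, are merged into one.\<close>
    moreover have "AE z in domain_M S. \<forall>a\<in>core_indices. T \<beta> (tensor d (partial_factor s j a)) z =
        tensor d (\<lambda>m. op_factor S \<beta> m (partial_factor s j a m)) z"
      by (intro AE_finite_allI finite_set elem partial_factor_mem s j)
    ultimately show ?thesis by eventually_elim simp
  qed
  then have "AE z in domain_M S. \<forall>\<beta>\<in>{..<op_rank S}. T \<beta> (partial_u S \<theta> s j) z = (\<Sum>a\<in>core_indices. core S a *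
       tensor d (\<lambda>m. op_factor S \<beta> m (partial_factor s j a m)) z)"
    by (intro AE_finite_allI) auto
  with A[OF mem(2)] show ?thesis by eventually_elim simp
qed

lemma eval1_eqI:
  assumes "m < d" "i < num_pts S m"
    and "continuous_on {lend S m..rend S m} g" "AE x in interval_M S m. f x = g x"
  shows "eval1 S m f (colloc S m i) = g (colloc S m i)"
  unfolding eval1_def
proof (rule pt_eval_eqI[OF assms(3,4)])
  show "colloc S m i \<in> {lend S m..rend S m}" using colloc_mem[OF assms(1,2)] by simp
  fix U assume "open U" "colloc S m i \<in> U"
  from interval_nbhd_not_null[of _ _ "lend S" m "rend S", OF this colloc_mem[OF assms(1,2)]]
  obtain A where "A \<in> sets (interval_M S m)" "A \<subseteq> U \<inter> {lend S m<..<rend S m}" "emeasure (interval_M S m) A \<noteq> 0"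
    unfolding interval_M_def by blast
  then show "\<exists>A\<in>sets (interval_M S m). A \<subseteq> U \<inter> {lend S m..rend S m} \<and> emeasure (interval_M S m) A \<noteq> 0"
    by (intro bexI[of _ A]) (auto dest: subsetD)
qed

text \<open>Collocation points are interior to the box, so their neighbourhoods have positive
  measure inside it and the evaluation is unambiguous.\<close>

lemma eval_dom_eqI:
  assumes i: "i \<in> set (multi_indices d (num_pts S))"
    and g: "continuous_on (\<Pi>\<^sub>E m\<in>{..<d}. {lend S m..rend S m}) g" "AE z in domain_M S. f z = g z"
  shows "eval_dom S f (colloc_pt S i) = g (colloc_pt S i)"
  unfolding eval_dom_def
proof (rule pt_eval_eqI[OF g])
  have z: "colloc_pt S i \<in> (\<Pi>\<^sub>E m\<in>{..<d}. {lend S m<..<rend S m})"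
    using colloc_mem in_multi_indices(2)[OF i] by (auto simp: colloc_pt_def)
  then show "colloc_pt S i \<in> (\<Pi>\<^sub>E m\<in>{..<d}. {lend S m..rend S m})"
    by (auto simp: PiE_iff less_imp_le)
  fix U assume "open U" "colloc_pt S i \<in> U"
  from box_nbhd_not_null[OF this z]
  show "\<exists>A\<in>sets (domain_M S). A \<subseteq> U \<inter> (\<Pi>\<^sub>E m\<in>{..<d}. {lend S m..rend S m}) \<and> emeasure (domain_M S) A \<noteq> 0"
    unfolding domain_M_def interval_M_def .
qed

text \<open>Products of continuous representatives of the factors give a continuous representative
  on the closed box, and the same representatives compute the one-dimensional evaluations.\<close>

lemma eval_dom_partial_u:
  assumes s: "s < d" and j: "j < num_par S s" and i: "i \<in> set (multi_indices d (num_pts S))"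
  shows "eval_dom S (op_A S (partial_u S \<theta> s j)) (colloc_pt S i) =
    (\<Sum>\<beta><op_rank S. \<Sum>a\<in>core_indices. core S a *
       (\<Prod>m<d. eval1 S m (op_factor S \<beta> m (partial_factor s j a m)) (colloc S m (i ! m))))"
proof -
  let ?I = "\<lambda>m. {lend S m..rend S m}"
  define g where "g \<beta> m a = (SOME g. continuous_on (?I m) g \<and>
      (AE x in interval_M S m. op_factor S \<beta> m (partial_factor s j a m) x = g x))" for \<beta> m a
  have "continuous_on (?I m) (g \<beta> m a) \<and>
      (AE x in interval_M S m. op_factor S \<beta> m (partial_factor s j a m) x = g \<beta> m a x)"
    if "\<beta> < op_rank S" "m < d" "a \<in> core_indices" for \<beta> m a
  proof -
    have "has_cont_rep (interval_M S m) (?I m) (op_factor S \<beta> m (partial_factor s j a m))"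
      using that j in_multi_indices(2)[OF that(3) that(2)]
      by (cases "m = s") (auto intro: cont_rep cont_rep_partial)
    then show ?thesis unfolding has_cont_rep_def g_def by (rule someI_ex)
  qed
  then have g: "\<And>\<beta> m a. \<lbrakk>\<beta> < op_rank S; m < d; a \<in> core_indices\<rbrakk> \<Longrightarrow> continuous_on (?I m) (g \<beta> m a)"
    and ae: "\<And>\<beta> m a. \<lbrakk>\<beta> < op_rank S; m < d; a \<in> core_indices\<rbrakk> \<Longrightarrow>
       AE x in interval_M S m. op_factor S \<beta> m (partial_factor s j a m) x = g \<beta> m a x"
    by auto
  let ?G = "\<lambda>z. \<Sum>\<beta><op_rank S. \<Sum>a\<in>core_indices. core S a * (\<Prod>m<d. g \<beta> m a (z m))"
  have "continuous_on (\<Pi>\<^sub>E m\<in>{..<d}. ?I m) ?G"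
  proof (intro continuous_intros)
    fix \<beta> a m assume "\<beta> \<in> {..<op_rank S}" "a \<in> core_indices" and m: "m \<in> {..<d}"
    then have "continuous_on (?I m) (g \<beta> m a)" by (intro g) simp_all
    \<comment> \<open>Composition with the coordinate projection requires that it maps the box into
      the interval on which \<open>g \<beta> m a\<close> is continuous.\<close>
    moreover have "(\<lambda>z. z m) ` (\<Pi>\<^sub>E m\<in>{..<d}. ?I m) \<subseteq> ?I m"
      by (rule image_subsetI, rule PiE_mem[OF _ m])
    ultimately show "continuous_on (\<Pi>\<^sub>E m\<in>{..<d}. ?I m) (\<lambda>z. g \<beta> m a (z m))"
      by (rule continuous_on_compose2[OF _ continuous_on_product_then_coordinatewise[OF continuous_on_id]])
  qed
  moreover have "AE z in domain_M S. op_A S (partial_u S \<theta> s j) z = ?G z"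
  proof -
    interpret product_sigma_finite "interval_M S"
      unfolding interval_M_def by (rule product_sigma_finite_interval)
    have "AE z in domain_M S. \<forall>\<beta>\<in>{..<op_rank S}. \<forall>a\<in>core_indices. \<forall>m\<in>{..<d}.
        op_factor S \<beta> m (partial_factor s j a m) (z m) = g \<beta> m a (z m)"
      unfolding domain_M_def
      by (intro AE_finite_allI finite_set finite_lessThan AE_PiM_component_finite ae) auto
    with op_A_partial_u_AE[OF s j] show ?thesis
      by eventually_elim (simp add: tensor_def)
  qed
  ultimately have "eval_dom S (op_A S (partial_u S \<theta> s j)) (colloc_pt S i) = ?G (colloc_pt S i)"
    by (rule eval_dom_eqI[OF i])
  also have "\<dots> = (\<Sum>\<beta><op_rank S. \<Sum>a\<in>core_indices. core S a *
       (\<Prod>m<d. eval1 S m (op_factor S \<beta> m (partial_factor s j a m)) (colloc S m (i ! m))))"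
    using eval1_eqI[OF _ in_multi_indices(2)[OF i] g ae]
    by (intro sum.cong refl arg_cong2[of _ _ _ _ "(*)"] prod.cong) (auto simp: colloc_pt_def)
  finally show ?thesis .
qed

text \<open>The inner index \<open>q\<close> encodes a pair as \<open>q div k\<close> and
  \<open>q mod k\<close>. The Kronecker delta retains only the pairs whose point index is that of
  row \<open>r\<close>; what remains is the full core sum, split by the value of
  \<open>a ! s\<close>.\<close>

lemma Psi_block2_mult_C_block2_index:
  assumes s: "s < d" and r: "r < N_D S" and j: "j < num_par S s"
  shows "(Psi_block2 S \<theta> s \<beta> * C_block2 S \<theta> s \<beta>) $$ (r, j) =
    (\<Sum>a\<in>core_indices. core S a *
       (\<Prod>m<d. eval1 S m (op_factor S \<beta> m (partial_factor s j a m)) (colloc S m (grid_index S r ! m))))"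
proof -
  let ?n = "num_pts S s" and ?k = "num_basis S s" and ?i = "grid_index S r"
  let ?e = "\<lambda>m f. eval1 S m (op_factor S \<beta> m f) (colloc S m (?i ! m))"
  have i: "?i \<in> set (multi_indices d (num_pts S))"
    using r by (intro nth_mem) (simp add: length_multi_indices N_D_def)
  have is_lt: "?i ! s < ?n" using in_multi_indices(2)[OF i s] .
  have "(Psi_block2 S \<theta> s \<beta> * C_block2 S \<theta> s \<beta>) $$ (r, j) =
      (\<Sum>q<?n * ?k. (if ?i ! s = q div ?k then E_entry S \<theta> s \<beta> ?i (q mod ?k) else 0) *
         eval1 S s (op_factor S \<beta> s (partial_basis S \<theta> s j (q mod ?k))) (colloc S s (q div ?k)))"
    using r j by (simp add: Psi_block2_def C_block2_def scalar_prod_def Let_def atLeast0LessThan)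
  \<comment> \<open>The surviving \<open>q\<close> form one contiguous run of length
    \<open>?k\<close>.\<close>
  also have "\<dots> = (\<Sum>q\<in>(\<lambda>b. ?i ! s * ?k + b) ` {..<?k}.
         E_entry S \<theta> s \<beta> ?i (q mod ?k) * ?e s (partial_basis S \<theta> s j (q mod ?k)))"
  proof (rule sum.mono_neutral_cong_right)
    show "(\<lambda>b. ?i ! s * ?k + b) ` {..<?k} \<subseteq> {..<?n * ?k}"
    proof clarsimp
      fix b assume "b < ?k"
      then have "?i ! s * ?k + b < Suc (?i ! s) * ?k" by simp
      also have "\<dots> \<le> ?n * ?k" using is_lt by (intro mult_right_mono) auto
      finally show "?i ! s * ?k + b < ?n * ?k" .
    qed
    have "q \<in> (\<lambda>b. ?i ! s * ?k + b) ` {..<?k}" if "q < ?n * ?k" "?i ! s = q div ?k" for q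
    proof (rule image_eqI)
      show "q = ?i ! s * ?k + q mod ?k" unfolding that(2) by (rule div_mult_mod_eq[symmetric])
      \<comment> \<open>For \<open>?k = 0\<close> there is no \<open>q\<close> below
        \<open>?n * ?k\<close>.\<close>
      have "?k > 0" using that(1) by (cases "?k = 0") auto
      then show "q mod ?k \<in> {..<?k}" by simp
    qed
    then show "\<forall>q\<in>{..<?n * ?k} - (\<lambda>b. ?i ! s * ?k + b) ` {..<?k}.
       (if ?i ! s = q div ?k then E_entry S \<theta> s \<beta> ?i (q mod ?k) else 0) *
         eval1 S s (op_factor S \<beta> s (partial_basis S \<theta> s j (q mod ?k))) (colloc S s (q div ?k)) = 0"
      by auto
  qed auto
  also have "\<dots> = (\<Sum>b<?k. E_entry S \<theta> s \<beta> ?i b * ?e s (partial_basis S \<theta> s j b))"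
    by (subst sum.reindex) (auto intro!: inj_onI)
  also have "\<dots> = (\<Sum>b<?k. \<Sum>a\<in>{a \<in> core_indices. a ! s = b}. core S a *
      (\<Prod>m<d. ?e m (partial_factor s j a m)))"
    unfolding E_entry_def sum_distrib_right
    \<comment> \<open>\<open>E_entry\<close> omits exactly factor \<open>s\<close>; the entry of
      \<open>C_block2\<close> supplies it, differentiated.\<close>
    by (intro sum.cong refl, subst prod.remove[of "{..<d}" s]) (use s in \<open>auto simp: mult_ac intro!: prod.cong\<close>)
  also have "\<dots> = (\<Sum>a\<in>core_indices. core S a * (\<Prod>m<d. ?e m (partial_factor s j a m)))"
    \<comment> \<open>The fibres of \<open>a ! s\<close> over \<open>{..<?k}\<close> exhaust the
      core indices.\<close>
    using in_multi_indices(2)[OF _ s] by (intro sum.group) auto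
  finally show ?thesis .
qed

section \<open>Block dimensions and assembly of the factored Jacobian, Gramian and gradient\<close>

lemma Psi_block2_carrier: "Psi_block2 S \<theta> s \<beta> \<in> carrier_mat (N_D S) (num_pts S s * num_basis S s)"
  by (simp add: Psi_block2_def)

lemma C_block2_carrier: "C_block2 S \<theta> s \<beta> \<in> carrier_mat (num_pts S s * num_basis S s) (num_par S s)"
  by (simp add: C_block2_def)

lemma Psi_block_carrier:
  "Psi_block S \<theta> s \<in> carrier_mat (N_D S) (op_rank S * num_pts S s * num_basis S s)"
  using hcat_carrier[where xs = "[0..<op_rank S]", OF Psi_block2_carrier[of s]]
  by (simp add: Psi_block_def sum_list_triv mult.assoc)

lemma C_block_carrier:
  "C_block S \<theta> s \<in> carrier_mat (op_rank S * num_pts S s * num_basis S s) (num_par S s)"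
  using vcat_carrier[where xs = "[0..<op_rank S]", OF C_block2_carrier[of s]]
  by (simp add: C_block_def sum_list_triv mult.assoc)

lemma Psi_carrier: "Psi S \<theta> \<in> carrier_mat (N_D S) (N_eff S)"
  using hcat_carrier[where xs = "[0..<d]", OF Psi_block_carrier]
  by (simp add: Psi_def N_eff_def sum_list_upt)

lemma C_mat_carrier: "C_mat S \<theta> \<in> carrier_mat (N_eff S) (P_total S)"
  using diag_block_mat_carrier[where xs = "[0..<d]", OF C_block_carrier]
  by (simp add: C_mat_def N_eff_def P_total_def sum_list_upt)

lemma jac_block_eq:
  assumes s: "s < d"
  shows "jac_block S \<theta> s = Psi_block S \<theta> s * C_block S \<theta> s"
proof (rule eq_matI)
  show "dim_row (jac_block S \<theta> s) = dim_row (Psi_block S \<theta> s * C_block S \<theta> s)"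
    "dim_col (jac_block S \<theta> s) = dim_col (Psi_block S \<theta> s * C_block S \<theta> s)"
    using Psi_block_carrier[of s] C_block_carrier[of s] by (auto simp: jac_block_def)
next
  fix r j assume "r < dim_row (Psi_block S \<theta> s * C_block S \<theta> s)" "j < dim_col (Psi_block S \<theta> s * C_block S \<theta> s)"
  then have r: "r < N_D S" and j: "j < num_par S s"
    using Psi_block_carrier[of s] C_block_carrier[of s] by auto
  have i: "grid_index S r \<in> set (multi_indices d (num_pts S))"
    using r by (intro nth_mem) (simp add: length_multi_indices N_D_def)
  have "(Psi_block S \<theta> s * C_block S \<theta> s) $$ (r, j) =
      (\<Sum>\<beta>\<leftarrow>[0..<op_rank S]. (Psi_block2 S \<theta> s \<beta> * C_block2 S \<theta> s \<beta>) $$ (r, j))"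
    unfolding Psi_block_def C_block_def
    by (rule hcat_mult_vcat_index[OF Psi_block2_carrier C_block2_carrier r j])
  also have "\<dots> = (\<Sum>\<beta><op_rank S. (Psi_block2 S \<theta> s \<beta> * C_block2 S \<theta> s \<beta>) $$ (r, j))"
    by (simp add: interv_sum_list_conv_sum_set_nat atLeast0LessThan)
  also have "\<dots> = jac_block S \<theta> s $$ (r, j)"
    using r j by (simp add: Psi_block2_mult_C_block2_index[OF s r j] jac_block_def eval_dom_partial_u[OF s j i])
  finally show "jac_block S \<theta> s $$ (r, j) = (Psi_block S \<theta> s * C_block S \<theta> s) $$ (r, j)" ..
qed

lemma jac_eq: "jac S \<theta> = Psi S \<theta> * C_mat S \<theta>"
proof -
  have "Psi S \<theta> * C_mat S \<theta> = hcat (N_D S) (map (\<lambda>s. Psi_block S \<theta> s * C_block S \<theta> s) [0..<d])"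
    unfolding Psi_def C_mat_def
    by (rule hcat_mult_diag_block_mat[OF Psi_block_carrier C_block_carrier])
  also have "\<dots> = jac S \<theta>"
    unfolding jac_def by (intro arg_cong[of _ _ "hcat _"] map_cong) (auto simp: jac_block_eq)
  finally show ?thesis ..
qed

lemma Gram_eq: "Gram S \<theta> = transpose_mat (C_mat S \<theta>) * Upsilon S \<theta> * C_mat S \<theta>"
proof -
  note P = Psi_carrier and C = C_mat_carrier
  have T: "transpose_mat (Psi S \<theta>) \<in> carrier_mat (N_eff S) (N_D S)"
    "transpose_mat (C_mat S \<theta>) \<in> carrier_mat (P_total S) (N_eff S)" using P C by auto
  have "transpose_mat (jac S \<theta>) * jac S \<theta> =
      transpose_mat (C_mat S \<theta>) * (transpose_mat (Psi S \<theta>) * Psi S \<theta>) * C_mat S \<theta>"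
    unfolding jac_eq transpose_mult[OF P C]
      assoc_mult_mat[OF T(2) T(1) mult_carrier_mat[OF P C]]
      assoc_mult_mat[OF T(2) mult_carrier_mat[OF T(1) P] C] assoc_mult_mat[OF T(1) P C] ..
  then show ?thesis
    unfolding Gram_def Upsilon_def
    using mult_smult_distrib[OF T(2) mult_carrier_mat[OF T(1) P]]
      mult_smult_assoc_mat[OF mult_carrier_mat[OF T(2) mult_carrier_mat[OF T(1) P]] C] by simp
qed

lemma grad_eq: "grad S \<theta> = transpose_mat (C_mat S \<theta>) *\<^sub>v rho_c S \<theta>"
proof -
  note P = Psi_carrier and C = C_mat_carrier
  have T: "transpose_mat (Psi S \<theta>) \<in> carrier_mat (N_eff S) (N_D S)"
    "transpose_mat (C_mat S \<theta>) \<in> carrier_mat (P_total S) (N_eff S)" using P C by auto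
  have r: "residual S \<theta> \<in> carrier_vec (N_D S)" by (simp add: residual_def)
  show ?thesis
    unfolding grad_def rho_c_def jac_eq transpose_mult[OF P C]
      assoc_mult_mat_vec[OF T(2,1) r] mult_mat_vec[OF T(2) mult_mat_vec_carrier[OF T(1) r]] ..
qed

end

theorem theorem3p1:
  fixes S :: problem and \<theta> :: "nat \<Rightarrow> real Matrix.vec" and \<mu> :: real
  assumes "separable_setting S \<theta>"
    and "\<mu> > 0"
  shows "invertible_mat (Upsilon S \<theta> * K_mat S \<theta> + \<mu> \<cdot>\<^sub>m 1\<^sub>m (N_eff S)) \<and>
    (\<exists>!\<delta>. \<delta> \<in> carrier_vec (P_total S) \<and>
        (Gram S \<theta> + \<mu> \<cdot>\<^sub>m 1\<^sub>m (P_total S)) *\<^sub>v \<delta> = grad S \<theta>) \<and>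
    (\<exists>!y. y \<in> carrier_vec (N_eff S) \<and>
        (Upsilon S \<theta> * K_mat S \<theta> + \<mu> \<cdot>\<^sub>m 1\<^sub>m (N_eff S)) *\<^sub>v y = rho_c S \<theta>) \<and>
    (\<forall>\<delta>\<in>carrier_vec (P_total S). \<forall>y\<in>carrier_vec (N_eff S).
        (Gram S \<theta> + \<mu> \<cdot>\<^sub>m 1\<^sub>m (P_total S)) *\<^sub>v \<delta> = grad S \<theta> \<longrightarrow>
        (Upsilon S \<theta> * K_mat S \<theta> + \<mu> \<cdot>\<^sub>m 1\<^sub>m (N_eff S)) *\<^sub>v y = rho_c S \<theta> \<longrightarrow>
        \<delta> = transpose_mat (C_mat S \<theta>) *\<^sub>v y)"
proof -
  interpret separable_setting S \<theta> by fact
  have Y: "Upsilon S \<theta> \<in> carrier_mat (N_eff S) (N_eff S)"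
    using Psi_carrier by (simp add: Upsilon_def)
  have r: "rho_c S \<theta> \<in> carrier_vec (N_eff S)"
    using Psi_carrier by (simp add: rho_c_def residual_def)
  have psd: "0 \<le> v \<bullet> (Upsilon S \<theta> *\<^sub>v v)" if "v \<in> carrier_vec (N_eff S)" for v
    unfolding Upsilon_def by (rule scaled_gram_psd[OF Psi_carrier that]) simp
  \<comment> \<open>All analysis is now contained in \<open>Gram_eq\<close> and
    \<open>grad_eq\<close>; after rewriting with them the claim is this instance.\<close>
  note sys = compressed_damped_system[OF C_mat_carrier Y r psd \<open>\<mu> > 0\<close>]
  show ?thesis
    unfolding Gram_eq grad_eq K_mat_def
    using sys(1-3) sys(4) by blast
qed

end
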